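(* Let $N\geq 2$ and $2\leq p<q<+\infty$. Let $a,b:\mathbb{Z}^N\to\mathbb{R}$ be nonnegative functions with $\lim_{|x|\to+\infty}a(x)=\bar a>0$ and $\lim_{|x|\to+\infty}b(x)=\bar b>0$, and assume that $I_0(\bar\Phi)>0$. If $\{u_n\}\subset\mathcal{E}_{p,q}$ is a Palais-Smale sequence of the functional $\Phi$ at level $c\in\mathbb{R}$, then there exist a nonnegative integer $k$, a solution $u_{(0)}\in\mathcal{E}_{p,q}$ to the equation $$-\Delta u+a(x)|u|^{p-2}u-b(x)|u|^{q-2}u=0,$$ $k$ nontrivial solutions $u_{(i)}\in\mathcal{E}_{p,q}$ ($i=1,\dots,k$) to the equation $$-\Delta u+\bar a|u|^{p-2}u-\bar b|u|^{q-2}u=0,$$ and $k$ sequences $\{y_n^i\}\subset\mathbb{Z}^N$, $i=1,\dots,k$, with $|y_n^i|\to+\infty$ and $|y_n^j-y_n^i|\to+\infty$ for $j\neq i$ as $n\to+\infty$, such that, up to a subsequence, (i) $u_n-u_{(0)}-\sum_{i=1}^{k}u_{(i)}(\cdot-y_n^i)\to 0$ in $\mathcal{E}_{p,q}$; (ii) $\Phi(u_{(0)})+\sum_{i=1}^{k}\bar\Phi(u_{(i)})=c$.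
   Context: The lattice graph $\mathbb{Z}^N$ has vertex set $\mathbb{Z}^N$ and edges $x\sim y$ iff $\sum_{i=1}^N|x_i-y_i|=1$; $|x-y|$ is the graph distance and $|x|=|x-0|$. For $u,v:\mathbb{Z}^N\to\mathbb{R}$: $\Delta u(x)=\sum_{y\sim x}(u(y)-u(x))$, $(\nabla u\nabla v)(x)=\frac12\sum_{y\sim x}(u(y)-u(x))(v(y)-v(x))$, $|\nabla u|(x)=\sqrt{(\nabla u\nabla u)(x)}$. $\mu$ is the counting measure, so $\int_{\mathbb{Z}^N} f\,d\mu=\sum_{x\in\mathbb{Z}^N}f(x)$, and $\|f\|_s=(\sum_x|f(x)|^s)^{1/s}$, $\|\nabla u\|_2=\||\nabla u|\|_2$. $\mathcal{E}_{p,q}$ is the completion of the finitely supported functions $C_c(\mathbb{Z}^N)$ in the norm $\|u\|_{\mathcal{E}_{p,q}}=\|\nabla u\|_2+\|u\|_p+\|u\|_q$, and $\mathcal{E}_{p,q}^*$ is its dual. The functionals on $\mathcal{E}_{p,q}$ are $$\Phi(u)=\tfrac12\int|\nabla u|^2d\mu+\tfrac1p\int a(x)|u|^p d\mu-\tfrac1q\int b(x)|u|^q d\mu,\qquad \bar\Phi(u)=\tfrac12\int|\nabla u|^2d\mu+\tfrac1p\int \bar a|u|^p d\mu-\tfrac1q\int \bar b|u|^q d\mu,$$ with derivative $\langle\Phi'(u),\phi\rangle=\int\nabla u\nabla\phi\,d\mu+\int a|u|^{p-2}u\phi\,d\mu-\int b|u|^{q-2}u\phi\,d\mu$, and similarly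 for $\bar\Phi$ with $\bar a,\bar b$. A function $u\in\mathcal{E}_{p,q}$ is a (weak) solution of the equation with coefficients $a,b$ if $\langle\Phi'(u),\phi\rangle=0$ for all $\phi\in C_c(\mathbb{Z}^N)$, and of the equation with coefficients $\bar a,\bar b$ if $\langle\bar\Phi'(u),\phi\rangle=0$ for all such $\phi$. Nontrivial means not identically zero. $I_0(\bar\Phi):=\inf_{u\in\mathcal{P}(\bar\Phi)}\bar\Phi(u)$, where $\mathcal{P}(\bar\Phi)$ is the set of all nontrivial critical points $u\in\mathcal{E}_{p,q}$ of $\bar\Phi$. $\{u_n\}$ is a Palais-Smale sequence of $\Phi$ at level $c$ if $\Phi(u_n)\to c$ and $\Phi'(u_n)\to0$ in $\mathcal{E}_{p,q}^*$. *)

theory Defs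
  imports "HOL-Analysis.Analysis"
begin

text \<open>The lattice graph on \<open>int ^ 'n\<close>, with \<open>N = CARD('n)\<close>.\<close>

definition lattice_adj :: "int ^ 'n \<Rightarrow> int ^ 'n \<Rightarrow> bool" where
  "lattice_adj x y \<longleftrightarrow> (\<Sum>i\<in>UNIV. \<bar>x $ i - y $ i\<bar>) = 1"

definition lattice_dist :: "int ^ 'n \<Rightarrow> int ^ 'n \<Rightarrow> nat" where
  "lattice_dist x y = (LEAST m. (lattice_adj ^^ m) x y)"

definition lattice_at_infinity :: "(int ^ 'n) filter" where
  "lattice_at_infinity = filtercomap (\<lambda>x. lattice_dist x 0) at_top"

definition grad_prod :: "(int ^ 'n \<Rightarrow> real) \<Rightarrow> (int ^ 'n \<Rightarrow> real) \<Rightarrow> int ^ 'n \<Rightarrow> real" where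
  "grad_prod u v x = (1 / 2) * (\<Sum>y | lattice_adj x y. (u y - u x) * (v y - v x))"

definition grad_abs :: "(int ^ 'n \<Rightarrow> real) \<Rightarrow> int ^ 'n \<Rightarrow> real" where
  "grad_abs u x = sqrt (grad_prod u u x)"

definition lp_finite :: "real \<Rightarrow> (int ^ 'n \<Rightarrow> real) \<Rightarrow> bool" where
  "lp_finite s f \<longleftrightarrow> (\<lambda>x. \<bar>f x\<bar> powr s) summable_on UNIV"

text \<open>Since \<open>infsum\<close> of a non-summable family is 0, this is the norm only under \<open>lp_finite s f\<close>.\<close>

definition lp_norm :: "real \<Rightarrow> (int ^ 'n \<Rightarrow> real) \<Rightarrow> real" where
  "lp_norm s f = (\<Sum>\<^sub>\<infinity>x. \<bar>f x\<bar> powr s) powr (1 / s)"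

definition finitely_supported :: "(int ^ 'n \<Rightarrow> real) set" where
  "finitely_supported = {\<phi>. finite {x. \<phi> x \<noteq> 0}}"

definition E_norm :: "real \<Rightarrow> real \<Rightarrow> (int ^ 'n \<Rightarrow> real) \<Rightarrow> real" where
  "E_norm p q u = lp_norm 2 (grad_abs u) + lp_norm p u + lp_norm q u"

text \<open>The completion of the finitely supported functions is realized as their closure in the
  space of all functions of finite norm. That space is complete: the norm dominates each
  \<open>\<bar>u x\<bar>\<close>, so Cauchy sequences converge pointwise, and the pointwise limit is the limit in norm.\<close>

definition E_space :: "real \<Rightarrow> real \<Rightarrow> (int ^ 'n \<Rightarrow> real) set" where
  "E_space p q =
     {u. lp_finite 2 (grad_abs u) \<and> lp_finite p u \<and> lp_finite q u \<and>
         (\<exists>\<phi>. (\<forall>m::nat. \<phi> m \<in> finitely_supported) \<and>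
              (\<lambda>m. E_norm p q (\<lambda>x. u x - \<phi> m x)) \<longlonglongrightarrow> 0)}"

definition energy ::
  "real \<Rightarrow> real \<Rightarrow> (int ^ 'n \<Rightarrow> real) \<Rightarrow> (int ^ 'n \<Rightarrow> real) \<Rightarrow> (int ^ 'n \<Rightarrow> real) \<Rightarrow> real" where
  "energy p q a b u =
     (1 / 2) * (\<Sum>\<^sub>\<infinity>x. (grad_abs u x)\<^sup>2)
     + (1 / p) * (\<Sum>\<^sub>\<infinity>x. a x * \<bar>u x\<bar> powr p)
     - (1 / q) * (\<Sum>\<^sub>\<infinity>x. b x * \<bar>u x\<bar> powr q)"

text \<open>\<open>energy_deriv p q a b u \<phi>\<close> is the pairing of the derivative at \<open>u\<close> with \<open>\<phi>\<close>.\<close>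

definition energy_deriv ::
  "real \<Rightarrow> real \<Rightarrow> (int ^ 'n \<Rightarrow> real) \<Rightarrow> (int ^ 'n \<Rightarrow> real) \<Rightarrow>
   (int ^ 'n \<Rightarrow> real) \<Rightarrow> (int ^ 'n \<Rightarrow> real) \<Rightarrow> real" where
  "energy_deriv p q a b u \<phi> =
     (\<Sum>\<^sub>\<infinity>x. grad_prod u \<phi> x)
     + (\<Sum>\<^sub>\<infinity>x. a x * \<bar>u x\<bar> powr (p - 2) * u x * \<phi> x)
     - (\<Sum>\<^sub>\<infinity>x. b x * \<bar>u x\<bar> powr (q - 2) * u x * \<phi> x)"

text \<open>The dual norm takes values in \<open>ennreal\<close> so that the supremum is meaningful for
  unbounded functionals as well.\<close>

definition E_dual_norm :: "real \<Rightarrow> real \<Rightarrow> ((int ^ 'n \<Rightarrow> real) \<Rightarrow> real) \<Rightarrow> ennreal" where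
  "E_dual_norm p q L = (SUP \<phi>\<in>{\<phi> \<in> E_space p q. E_norm p q \<phi> \<le> 1}. ennreal \<bar>L \<phi>\<bar>)"

definition weak_solution ::
  "real \<Rightarrow> real \<Rightarrow> (int ^ 'n \<Rightarrow> real) \<Rightarrow> (int ^ 'n \<Rightarrow> real) \<Rightarrow> (int ^ 'n \<Rightarrow> real) \<Rightarrow> bool" where
  "weak_solution p q a b u \<longleftrightarrow>
     u \<in> E_space p q \<and> (\<forall>\<phi>\<in>finitely_supported. energy_deriv p q a b u \<phi> = 0)"

definition nontrivial :: "(int ^ 'n \<Rightarrow> real) \<Rightarrow> bool" where
  "nontrivial u \<longleftrightarrow> (\<exists>x. u x \<noteq> 0)"

definition nontrivial_critical_points ::
  "real \<Rightarrow> real \<Rightarrow> (int ^ 'n \<Rightarrow> real) \<Rightarrow> (int ^ 'n \<Rightarrow> real) \<Rightarrow> (int ^ 'n \<Rightarrow> real) set" where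
  "nontrivial_critical_points p q a b =
     {u \<in> E_space p q. nontrivial u \<and> (\<forall>\<phi>\<in>E_space p q. energy_deriv p q a b u \<phi> = 0)}"

text \<open>The infimum is taken in \<open>ereal\<close>, so it is \<open>\<infinity>\<close> if there are no nontrivial critical points.\<close>

definition I0 :: "real \<Rightarrow> real \<Rightarrow> (int ^ 'n \<Rightarrow> real) \<Rightarrow> (int ^ 'n \<Rightarrow> real) \<Rightarrow> ereal" where
  "I0 p q a b = (INF u\<in>nontrivial_critical_points p q a b. ereal (energy p q a b u))"

definition palais_smale ::
  "real \<Rightarrow> real \<Rightarrow> (int ^ 'n \<Rightarrow> real) \<Rightarrow> (int ^ 'n \<Rightarrow> real) \<Rightarrow> real \<Rightarrow>
   (nat \<Rightarrow> int ^ 'n \<Rightarrow> real) \<Rightarrow> bool" where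
  "palais_smale p q a b c u \<longleftrightarrow>
     (\<forall>n. u n \<in> E_space p q) \<and>
     (\<lambda>n. energy p q a b (u n)) \<longlonglongrightarrow> c \<and>
     (\<lambda>n. E_dual_norm p q (energy_deriv p q a b (u n))) \<longlonglongrightarrow> 0"

end

theory Submission
  imports Defs
begin

text \<open>A Palais-Smale sequence is bounded, hence converges pointwise along a subsequence. Subtracting
  the pointwise limit splits both the energy and its derivative asymptotically (Brezis-Lieb), so the
  difference is a Palais-Smale sequence of the limit functional at the level lowered by the energy of
  the limit. If it does not tend to 0 uniformly, some translates converge pointwise to a
  nontrivial critical point of the limit functional, which is subtracted in turn and lowers
  the level by at least \<open>I\<^sub>0 > 0\<close>. Since levels of Palais-Smale sequences of the limit functional are
  nonnegative, this stops; and uniform convergence to 0 implies convergence in norm.\<close>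

subsection \<open>Dominated convergence and perturbation of homogeneous functions\<close>

text \<open>Pointwise limits play the part of weak limits: a bound in l^p bounds every value, so
  compactness of a product of intervals supplies subsequences, and sums converge by dominated
  convergence with a majorant that is fixed up to \<eta> times a family of bounded sums. After each
  subtraction the derivative at the remainder must again tend to 0 in the dual norm, so derivatives
  have to split against test functions that move with n; this shapes \<open>ps_seq\<close> and the
  splitting lemmas. Since l^p embeds in l^q, the Dirichlet sum and the l^p sum govern the whole
  norm, and because p < q uniform smallness forces the q-sum to 0. The obstacle to boundedness is
  that a may vanish at finitely many points, so that the coercive part of \<Phi> bounds the l^p norm
  only through a nonlinear estimate; it is paired with a normalisation of the test function that has
  the matching exponent.\<close>

lemma summable_on_real_comparison:
  fixes f g :: "'a \<Rightarrow> real"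
  assumes "g summable_on A" "\<And>x. x \<in> A \<Longrightarrow> \<bar>f x\<bar> \<le> g x"
  shows "f summable_on A"
proof -
  have "(\<lambda>x. norm (f x)) summable_on A"
    by (rule Infinite_Sum.abs_summable_on_comparison_test'[OF assms(1)]) (use assms(2) in simp)
  then show ?thesis by (rule abs_summable_summable)
qed

lemma abs_infsum_le:
  fixes f g :: "'a \<Rightarrow> real"
  assumes "g summable_on A" "\<And>x. x \<in> A \<Longrightarrow> \<bar>f x\<bar> \<le> g x"
  shows "\<bar>infsum f A\<bar> \<le> infsum g A"
proof -
  have *: "f summable_on A" using summable_on_real_comparison assms by blast
  then have **: "(\<lambda>x. - f x) summable_on A" by (simp add: summable_on_uminus)
  have "infsum f A \<le> infsum g A"
    by (rule infsum_mono[OF * assms(1)]) (use assms(2) in fastforce)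
  moreover have "infsum (\<lambda>x. - f x) A \<le> infsum g A"
    by (rule infsum_mono[OF ** assms(1)]) (use assms(2) in fastforce)
  ultimately show ?thesis by (simp add: infsum_uminus)
qed

lemma summable_diff_real:
  fixes f g :: "'a \<Rightarrow> real"
  assumes "f summable_on A" "g summable_on A"
  shows "(\<lambda>x. f x - g x) summable_on A"
  using summable_on_add[OF assms(1), of "\<lambda>x. - g x"] assms(2) by (simp add: summable_on_uminus)

lemma infsum_diff_real:
  fixes f g :: "'a \<Rightarrow> real"
  assumes "f summable_on A" "g summable_on A"
  shows "infsum (\<lambda>x. f x - g x) A = infsum f A - infsum g A"
  using infsum_add[OF assms(1), of "\<lambda>x. - g x"] assms(2)
  by (simp add: infsum_uminus summable_on_uminus)

lemma le_infsum_real: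
  fixes f :: "'a \<Rightarrow> real"
  assumes "f summable_on UNIV" "\<And>x. f x \<ge> 0"
  shows "f x \<le> infsum f UNIV"
  using finite_sum_le_infsum[OF assms(1), of "{x}"] assms(2) by simp

text \<open>The part \<eta> \<open>w n\<close> of the majorant may move with n, because its sum is
  at most \<eta> M uniformly. Pointwise convergence acts on a finite set outside which the sum of g
  is small.\<close>

lemma infsum_tendsto_0_almost_dominated:
  fixes h w :: "nat \<Rightarrow> 'a \<Rightarrow> real"
  assumes lim: "\<And>x. (\<lambda>n. h n x) \<longlonglongrightarrow> 0"
    and dom: "\<And>\<eta>. \<eta> > 0 \<Longrightarrow> \<exists>g. g summable_on UNIV \<and> (\<forall>n x. \<bar>h n x\<bar> \<le> \<eta> * w n x + g x)"
    and w: "\<And>n. w n summable_on UNIV" "\<And>n x. w n x \<ge> 0" "\<And>n. infsum (w n) UNIV \<le> M"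
  shows "(\<lambda>n. infsum (h n) UNIV) \<longlonglongrightarrow> 0"
proof (rule LIMSEQ_I)
  fix e :: real assume e: "e > 0"
  have "M \<ge> 0" using w(3)[of 0] infsum_nonneg[of UNIV "w 0"] w(2) by force
  \<comment> \<open>This gives \<eta> M \<le> e/4, also for M = 0. The finite part, the tail of g
    and the moving part then cost e/4 each.\<close>
  define \<eta> where "\<eta> = e / (4 * (M + 1))"
  have \<eta>: "\<eta> > 0" "\<eta> * M \<le> e / 4" using e \<open>M \<ge> 0\<close> by (auto simp: \<eta>_def field_simps)
  obtain g where g: "g summable_on UNIV" and hg: "\<And>n x. \<bar>h n x\<bar> \<le> \<eta> * w n x + g x"
    using dom[OF \<eta>(1)] by blast
  obtain K where K: "finite K" and Kg: "\<bar>sum g K - infsum g UNIV\<bar> \<le> e / 4"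
    using infsum_finite_approximation[OF g, of "e/4"] e by (auto simp: dist_real_def)
  have "(\<lambda>n. \<Sum>x\<in>K. \<bar>h n x\<bar>) \<longlonglongrightarrow> (\<Sum>x\<in>K. \<bar>0\<bar>)"
    by (intro tendsto_sum tendsto_rabs lim)
  then have "eventually (\<lambda>n. (\<Sum>x\<in>K. \<bar>h n x\<bar>) < e / 4) sequentially"
    using e by (intro order_tendstoD(2)) auto
  then obtain n0 where n0: "\<And>n. n \<ge> n0 \<Longrightarrow> (\<Sum>x\<in>K. \<bar>h n x\<bar>) < e / 4"
    by (auto simp: eventually_sequentially)
  show "\<exists>no. \<forall>n\<ge>no. norm (infsum (h n) UNIV - 0) < e"
  proof (intro exI allI impI)
    fix n assume n: "n \<ge> n0"
    have sw: "(\<lambda>x. \<eta> * w n x) summable_on UNIV" using w(1) by (rule summable_on_cmult_right)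
    have gc: "g summable_on (-K)" using g by (rule summable_on_subset_banach) auto
    have swK: "(\<lambda>x. \<eta> * w n x) summable_on (-K)"
      using sw by (rule summable_on_subset_banach) auto
    have sh: "h n summable_on UNIV"
      by (rule summable_on_real_comparison[OF summable_on_add[OF sw g] hg])
    have shK: "h n summable_on (-K)" using sh by (rule summable_on_subset_banach) auto
    have "infsum (h n) (K \<union> -K) = infsum (h n) K + infsum (h n) (-K)"
      using K shK by (intro infsum_Un_disjoint) auto
    then have 1: "infsum (h n) UNIV = sum (h n) K + infsum (h n) (-K)" using K by simp
    have "infsum g (K \<union> -K) = infsum g K + infsum g (-K)"
      using K gc by (intro infsum_Un_disjoint) auto
    then have 2: "infsum g UNIV = sum g K + infsum g (-K)" using K by simp
    have "\<bar>infsum (h n) (-K)\<bar> \<le> infsum (\<lambda>x. \<eta> * w n x + g x) (-K)"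
      by (rule abs_infsum_le[OF summable_on_add[OF swK gc] hg])
    also have "\<dots> = infsum (\<lambda>x. \<eta> * w n x) (-K) + infsum g (-K)"
      by (rule infsum_add[OF swK gc])
    also have "infsum (\<lambda>x. \<eta> * w n x) (-K) \<le> infsum (\<lambda>x. \<eta> * w n x) UNIV"
      using \<eta>(1) w(2) by (intro infsum_mono_neutral swK sw) auto
    also have "\<dots> \<le> \<eta> * M" using \<eta>(1) w(3)[of n] by (simp add: infsum_cmult_right')
    finally have "\<bar>infsum (h n) (-K)\<bar> \<le> \<eta> * M + infsum g (-K)" by simp
    moreover have "\<bar>sum (h n) K\<bar> < e / 4"
      using n0[OF n] sum_abs[of "h n" K] by linarith
    ultimately show "norm (infsum (h n) UNIV - 0) < e" using 1 2 Kg \<eta>(2) e by (simp add: abs_if split: if_splits)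
  qed
qed

text \<open>Tychonoff for the product of the intervals [-M, M]; the function space over a countable
  type is metrizable, so compactness is sequential.\<close>

lemma pointwise_convergent_subsequence:
  fixes u :: "nat \<Rightarrow> 'a::countable \<Rightarrow> real"
  assumes "\<And>n x. \<bar>u n x\<bar> \<le> M"
  obtains r w where "strict_mono (r :: nat \<Rightarrow> nat)" "\<And>x. (\<lambda>n. u (r n) x) \<longlonglongrightarrow> w x"
proof -
  define S where "S = (PiE UNIV (\<lambda>_. {-M..M}) :: ('a \<Rightarrow> real) set)"
  have "compactin (product_topology (\<lambda>_. euclidean) (UNIV :: 'a set)) S"
    unfolding S_def by (subst compactin_PiE) auto
  then have "compact S" by (simp add: euclidean_product_topology)
  moreover have "u n \<in> S" for n
    unfolding S_def by (intro PiE_I) (use assms[of n] in \<open>auto simp: abs_le_iff intro: minus_le_iff[THEN iffD1]\<close>)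
  ultimately have "seq_compact S" "\<forall>n. u n \<in> S" by (auto simp: compact_eq_seq_compact_metric)
  then obtain w r where "strict_mono (r::nat\<Rightarrow>nat)" and w: "(u \<circ> r) \<longlonglongrightarrow> w"
    by (rule seq_compactE)
  moreover have "(\<lambda>n. u (r n) x) \<longlonglongrightarrow> w x" for x
    using continuous_on_tendsto_compose[OF continuous_on_product_coordinates[of x] w] by simp
  ultimately show ?thesis using that by blast
qed

text \<open>Scaling moves s to 1 or -1, where uniform continuity makes the change at most \<eta> for
  t small relative to s. If t is not small relative to s, both values are bounded by a multiple of
  |t|^r.\<close>

lemma homogeneous_perturbation:
  fixes f :: "real \<Rightarrow> real"
  assumes cont: "continuous_on UNIV f" and r: "r > 0"
    and hom: "\<And>l t. l > 0 \<Longrightarrow> f (l * t) = l powr r * f t"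
    and \<eta>: "\<eta> > 0"
  shows "\<exists>C\<ge>0. \<forall>s t. \<bar>f (s + t) - f s\<bar> \<le> \<eta> * \<bar>s\<bar> powr r + C * \<bar>t\<bar> powr r"
proof -
  define B where "B = \<bar>f 1\<bar> + \<bar>f (-1)\<bar>"
  have f0: "f 0 = 0"
  proof -
    have "f 0 = 2 powr r * f 0" using hom[of 2 0] by simp
    moreover have "(2::real) powr r > 1" using r by simp
    ultimately show ?thesis by (metis mult_cancel_right2 less_irrefl)
  qed
  have fB: "\<bar>f t\<bar> \<le> B * \<bar>t\<bar> powr r" for t
  proof -
    consider "t = 0" | "t > 0" | "t < 0" by linarith
    then show ?thesis
    proof cases
      case 1 then show ?thesis by (simp add: f0)
    next
      case 2 then show ?thesis using hom[of t 1] by (simp add: abs_mult B_def algebra_simps)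
    next
      case 3 then show ?thesis using hom[of "-t" "-1"] by (simp add: abs_mult B_def algebra_simps)
    qed
  qed
  have "uniformly_continuous_on {-2..2} f"
    by (intro compact_uniformly_continuous continuous_on_subset[OF cont]) auto
  then obtain d where d: "d > 0"
    and d': "\<And>x y. \<lbrakk>x \<in> {-2..2}; y \<in> {-2..2}; \<bar>y - x\<bar> < d\<rbrakk> \<Longrightarrow> \<bar>f y - f x\<bar> < \<eta>"
    unfolding uniformly_continuous_on_def dist_real_def using \<eta> by meson
  \<comment> \<open>The bound 1 keeps the perturbed points in [-2, 2], where f is uniformly
    continuous.\<close>
  define \<delta> where "\<delta> = min 1 (d / 2)"
  have \<delta>: "0 < \<delta>" "\<delta> \<le> 1" "\<delta> < d" using d by (auto simp: \<delta>_def)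
  \<comment> \<open>When |s| \<le> |t| / \<delta>, both |s| and |s + t| are at most (1 + 1/\<delta>)
    |t|; the factor 2 counts the two values of f.\<close>
  define C where "C = 2 * B * (1 + 1 / \<delta>) powr r"
  have B: "B \<ge> 0" by (simp add: B_def)
  have "\<bar>f (s + t) - f s\<bar> \<le> \<eta> * \<bar>s\<bar> powr r + C * \<bar>t\<bar> powr r" for s t
  proof (cases "s \<noteq> 0 \<and> \<bar>t\<bar> \<le> \<delta> * \<bar>s\<bar>")
    case True
    then have s: "\<bar>s\<bar> > 0" by simp
    have e: "f (s + t) = \<bar>s\<bar> powr r * f (s / \<bar>s\<bar> + t / \<bar>s\<bar>)" "f s = \<bar>s\<bar> powr r * f (s / \<bar>s\<bar>)"
      using hom[OF s, of "s / \<bar>s\<bar> + t / \<bar>s\<bar>"] hom[OF s, of "s / \<bar>s\<bar>"] s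
      by (simp_all add: distrib_left)
    have t: "\<bar>t / \<bar>s\<bar>\<bar> \<le> \<delta>" using True by (simp add: pos_divide_le_eq)
    moreover have "s / \<bar>s\<bar> = 1 \<or> s / \<bar>s\<bar> = -1" using s by (auto simp: abs_if)
    moreover have "\<bar>f (z + w) - f z\<bar> < \<eta>" if "\<bar>w\<bar> \<le> \<delta>" "z = 1 \<or> z = -1" for z w
      using \<delta> that by (intro d') auto
    ultimately have "\<bar>f (s / \<bar>s\<bar> + t / \<bar>s\<bar>) - f (s / \<bar>s\<bar>)\<bar> < \<eta>"
      by blast
    then have "\<bar>f (s + t) - f s\<bar> \<le> \<eta> * \<bar>s\<bar> powr r"
      unfolding e right_diff_distrib[symmetric] abs_mult by (simp add: mult.commute[of \<eta>] mult_left_mono)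
    then show ?thesis using B by (simp add: C_def add_increasing2)
  next
    case False
    then have st: "\<bar>s\<bar> \<le> \<bar>t\<bar> / \<delta>" using \<delta>(1) by (auto simp: field_simps)
    have *: "\<bar>f z\<bar> \<le> B * ((1 + 1 / \<delta>) powr r * \<bar>t\<bar> powr r)" if "\<bar>z\<bar> \<le> \<bar>t\<bar> + \<bar>t\<bar> / \<delta>" for z
    proof -
      have "\<bar>z\<bar> powr r \<le> ((1 + 1 / \<delta>) * \<bar>t\<bar>) powr r"
        using that r by (intro powr_mono2) (auto simp: algebra_simps)
      also have "\<dots> = (1 + 1 / \<delta>) powr r * \<bar>t\<bar> powr r" using \<delta> by (simp add: powr_mult)
      finally show ?thesis using fB[of z] B by (meson mult_left_mono order_trans)
    qed
    have "\<bar>f (s + t)\<bar> \<le> B * ((1 + 1 / \<delta>) powr r * \<bar>t\<bar> powr r)"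
      using st by (intro *) linarith
    moreover have "\<bar>f s\<bar> \<le> B * ((1 + 1 / \<delta>) powr r * \<bar>t\<bar> powr r)"
      using st by (intro *) linarith
    ultimately have "\<bar>f (s + t) - f s\<bar> \<le> C * \<bar>t\<bar> powr r" by (simp add: C_def algebra_simps)
    then show ?thesis using \<eta> by (simp add: add_increasing)
  qed
  moreover have "C \<ge> 0" using B by (simp add: C_def)
  ultimately show ?thesis by blast
qed

lemma abs_powr_homogeneous:
  assumes "l > (0::real)" shows "\<bar>l * t\<bar> powr s = l powr s * \<bar>t\<bar> powr s"
  using assms by (simp add: abs_mult powr_mult)

section \<open>The powers |t|^s and |t|^(s-2) t, and Young's inequality\<close>

lemma continuous_abs_powr:
  assumes "s > 0" shows "continuous_on UNIV (\<lambda>t::real. \<bar>t\<bar> powr s)"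
  using assms by (intro continuous_on_powr' continuous_intros) auto

text \<open>The derivative of |t|^s / s for s > 1, that is, the nonlinearity of the
  equation.\<close>

definition sgn_powr :: "real \<Rightarrow> real \<Rightarrow> real" where
  "sgn_powr s t = \<bar>t\<bar> powr (s - 2) * t"

lemma sgn_powr_0 [simp]: "sgn_powr s 0 = 0"
  by (simp add: sgn_powr_def)

lemma abs_sgn_powr: "\<bar>sgn_powr s t\<bar> = \<bar>t\<bar> powr (s - 1)"
proof (cases "t = 0")
  case False
  have "\<bar>t\<bar> powr (s - 2) * \<bar>t\<bar> powr 1 = \<bar>t\<bar> powr (s - 1)"
    by (subst powr_add[symmetric]) simp
  then show ?thesis using False by (simp add: sgn_powr_def abs_mult)
qed simp

lemma sgn_powr_mult_self: "sgn_powr s t * t = \<bar>t\<bar> powr s"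
proof (cases "t = 0")
  case False
  have "\<bar>t\<bar> powr (s - 2) * \<bar>t\<bar> powr 2 = \<bar>t\<bar> powr s"
    by (subst powr_add[symmetric]) simp
  then show ?thesis using False by (simp add: sgn_powr_def power2_eq_square mult.assoc)
qed simp

lemma sgn_powr_homogeneous:
  assumes "l > 0" shows "sgn_powr s (l * t) = l powr (s - 1) * sgn_powr s t"
proof -
  have "l powr (s - 2) * l powr 1 = l powr (s - 1)"
    by (subst powr_add[symmetric]) simp
  then show ?thesis using assms by (simp add: sgn_powr_def abs_powr_homogeneous)
qed

text \<open>Already for s = 2 the factor \<open>\<bar>t\<bar> powr (s - 2)\<close> jumps at 0, since
  \<open>0 powr 0 = 0\<close>. Powers of the positive and negative parts have the positive exponent
  s - 1 instead.\<close>

lemma continuous_sgn_powr: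
  assumes "s > 1" shows "continuous_on UNIV (sgn_powr s)"
proof -
  have "sgn_powr s t = (max t 0) powr (s - 1) - (max (- t) 0) powr (s - 1)" for t
  proof (cases "t \<ge> 0")
    case True
    then have "sgn_powr s t \<ge> 0" by (simp add: sgn_powr_def)
    then show ?thesis using True abs_sgn_powr[of s t] by simp
  next
    case False
    then have "sgn_powr s t \<le> 0" by (simp add: sgn_powr_def mult_nonneg_nonpos)
    then show ?thesis using False abs_sgn_powr[of s t] by simp
  qed
  then have "sgn_powr s = (\<lambda>t. (max t 0) powr (s - 1) - (max (- t) 0) powr (s - 1))" by blast
  moreover have "continuous_on UNIV (\<lambda>t::real. (max t 0) powr (s - 1) - (max (- t) 0) powr (s - 1))"
    using assms by (intro continuous_intros continuous_on_powr') auto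
  ultimately show ?thesis by simp
qed

text \<open>Compare T with Y / L: the larger of L T and Y pays for the product. Either of the two
  constants can be made small by the choice of L.\<close>

lemma young_powr:
  fixes T Y L s :: real
  assumes "L > 0" "s > 1" "T \<ge> 0" "Y \<ge> 0"
  shows "T powr (s - 1) * Y \<le> L powr (1 - s) * Y powr s + L * T powr s"
proof (cases "Y = 0")
  case True
  then show ?thesis using assms by simp
next
  case False
  then have Y: "Y > 0" using assms by simp
  have e: "y powr (s - 1) * y = y powr s" if "y > 0" for y :: real
    using powr_add[of y "s - 1" 1] that by simp
  show ?thesis
  proof (cases "T \<le> Y / L")
    case True
    have "T powr (s - 1) \<le> (Y / L) powr (s - 1)" using True assms by (intro powr_mono2) auto
    also have "\<dots> = L powr (1 - s) * Y powr (s - 1)"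
      using Y assms by (simp add: powr_divide powr_minus_divide[of L "s - 1", simplified])
    finally have "T powr (s - 1) * Y \<le> L powr (1 - s) * Y powr (s - 1) * Y"
      using Y by (simp add: mult_right_mono)
    then show ?thesis using e[OF Y] assms by (simp add: mult.assoc add_increasing2)
  next
    case False
    moreover have "Y / L > 0" using Y assms by simp
    ultimately have T: "T > 0" "Y \<le> L * T" using assms by (linarith, simp add: field_simps)
    have "T powr (s - 1) * Y \<le> T powr (s - 1) * (L * T)"
      using T by (intro mult_left_mono) auto
    also have "\<dots> = L * T powr s" using e[OF T(1)] by (simp add: algebra_simps)
    finally show ?thesis by (simp add: add_increasing)
  qed
qed

lemma young_powr_small:
  assumes "\<eta> > 0" "s > 1"
  obtains C where "C \<ge> 0" "\<And>T Y::real. \<lbrakk>T \<ge> 0; Y \<ge> 0\<rbrakk> \<Longrightarrow> T powr (s - 1) * Y \<le> \<eta> * Y powr s + C * T powr s"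
proof
  define L where "L = \<eta> powr (1 / (1 - s))"
  show "L \<ge> 0" by (simp add: L_def)
  have "L powr (1 - s) = \<eta>" using assms by (simp add: L_def powr_powr)
  then show "T powr (s - 1) * Y \<le> \<eta> * Y powr s + L * T powr s" if "T \<ge> 0" "Y \<ge> 0" for T Y
    using young_powr[of L s T Y] assms that by (simp add: L_def)
qed

lemma abs_add_powr_le:
  fixes x y s :: real
  assumes "s \<ge> 0" shows "\<bar>x + y\<bar> powr s \<le> 2 powr s * (\<bar>x\<bar> powr s + \<bar>y\<bar> powr s)"
proof -
  have "\<bar>x + y\<bar> powr s \<le> (2 * max \<bar>x\<bar> \<bar>y\<bar>) powr s"
    using assms by (intro powr_mono2) auto
  also have "\<dots> = 2 powr s * max \<bar>x\<bar> \<bar>y\<bar> powr s" by (simp add: powr_mult)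
  also have "\<dots> \<le> 2 powr s * (\<bar>x\<bar> powr s + \<bar>y\<bar> powr s)"
    by (intro mult_left_mono) (auto simp: max_def)
  finally show ?thesis .
qed

subsection \<open>The lattice graph\<close>

text \<open>Every neighbourhood is a translate of this set, so sums over neighbours run over one
  fixed finite index set.\<close>

definition lattice_dirs :: "(int ^ 'n) set" where
  "lattice_dirs = {e. lattice_adj 0 e}"

lemma lattice_adj_add [simp]: "lattice_adj (x + z) (y + z) \<longleftrightarrow> lattice_adj x y"
  by (simp add: lattice_adj_def)

lemma lattice_adj_iff_dirs: "lattice_adj x y \<longleftrightarrow> y - x \<in> lattice_dirs"
  using lattice_adj_add[of 0 x "y - x"] by (simp add: lattice_dirs_def)

lemma neighbours_eq: "{y. lattice_adj x y} = (+) x ` lattice_dirs"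
proof -
  have "y \<in> (+) x ` lattice_dirs" if "y - x \<in> lattice_dirs" for y
    using imageI[OF that, of "(+) x"] by simp
  then show ?thesis by (auto simp: lattice_adj_iff_dirs)
qed

lemma finite_lattice_dirs [simp]: "finite (lattice_dirs :: (int ^ 'n) set)"
proof -
  have "vec_nth ` (lattice_dirs :: (int ^ 'n) set) \<subseteq> PiE UNIV (\<lambda>_. {-1..1})"
  proof (intro subsetI PiE_I)
    fix f i assume "f \<in> vec_nth ` (lattice_dirs :: (int ^ 'n) set)"
    then obtain e :: "int ^ 'n" where e: "e \<in> lattice_dirs" "f = vec_nth e" by blast
    have "\<bar>e $ i\<bar> \<le> (\<Sum>i\<in>UNIV. \<bar>e $ i\<bar>)" by (rule member_le_sum) auto
    then show "f i \<in> {-1..1}" using e by (auto simp: lattice_dirs_def lattice_adj_def)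
  qed auto
  then have "finite (vec_nth ` (lattice_dirs :: (int ^ 'n) set))"
    by (rule finite_subset) (intro finite_PiE, auto)
  moreover have "inj_on vec_nth (lattice_dirs :: (int ^ 'n) set)"
    by (rule inj_onI) (simp add: vec_eq_iff)
  ultimately show ?thesis using finite_imageD by blast
qed

text \<open>Induction on the l^1 distance: a unit step in a coordinate where the points differ
  lowers it by 1. Thus the \<open>LEAST\<close> in \<open>lattice_dist\<close> is attained.\<close>

lemma lattice_connected: "\<exists>m. (lattice_adj ^^ m) (x :: int ^ 'n) y"
proof -
  have "\<exists>m. (lattice_adj ^^ m) x y" if "(\<Sum>i\<in>UNIV. \<bar>x $ i - y $ i\<bar>) = int k" for k and x :: "int ^ 'n"
    using that
  proof (induction k arbitrary: x)
    case 0
    then have "\<forall>i. \<bar>x $ i - y $ i\<bar> = 0" by (simp add: sum_nonneg_eq_0_iff)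
    then have "x = y" by (simp add: vec_eq_iff)
    then have "(lattice_adj ^^ 0) x y" by simp
    then show ?case by blast
  next
    case (Suc k)
    have "\<exists>i. x $ i \<noteq> y $ i"
    proof (rule ccontr)
      assume "\<not> (\<exists>i. x $ i \<noteq> y $ i)"
      then show False using Suc.prems by simp
    qed
    then obtain i where i: "x $ i \<noteq> y $ i" by blast
    define x' where "x' = x + axis i (sgn (y $ i - x $ i))"
    have sg: "\<bar>sgn (y $ i - x $ i)\<bar> = 1" using i by (auto simp: sgn_if)
    have x'_nth: "x' $ j = (if j = i then x $ i + sgn (y $ i - x $ i) else x $ j)" for j
      by (simp add: x'_def axis_def)
    have "(\<Sum>j\<in>UNIV. \<bar>x $ j - x' $ j\<bar>) = (\<Sum>j\<in>UNIV. if j = i then 1 else 0)"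
      using i by (intro sum.cong) (auto simp: x'_nth sgn_if)
    then have adj: "lattice_adj x x'" by (simp add: lattice_adj_def)
    have "(\<Sum>j\<in>UNIV. \<bar>x' $ j - y $ j\<bar>) = (\<Sum>j\<in>UNIV. \<bar>x $ j - y $ j\<bar> - (if j = i then 1 else 0))"
      using i by (intro sum.cong) (auto simp: x'_nth sgn_if)
    also have "\<dots> = int k" using Suc.prems by (simp add: sum_subtractf)
    finally obtain m where "(lattice_adj ^^ m) x' y" using Suc.IH by blast
    then have "(lattice_adj ^^ Suc m) x y" using adj relpowp_Suc_I2 by metis
    then show ?case by blast
  qed
  from this[of x "nat (\<Sum>i\<in>UNIV. \<bar>x $ i - y $ i\<bar>)"] show ?thesis by (simp add: sum_nonneg)
qed

text \<open>Quantifying over the end point y builds in translation invariance: the set collects the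
  differences of all pairs joined by m steps, and one more step subtracts an element of
  \<open>lattice_dirs\<close>.\<close>

lemma finite_lattice_sphere: "finite {d :: int ^ 'n. \<exists>y. (lattice_adj ^^ m) (y + d) y}"
proof (induction m)
  case 0
  have "{d :: int ^ 'n. \<exists>y. (lattice_adj ^^ 0) (y + d) y} \<subseteq> {0}" by auto
  then show ?case using finite_subset by blast
next
  case (Suc m)
  let ?S = "{d :: int ^ 'n. \<exists>y. (lattice_adj ^^ m) (y + d) y}"
  have "{d :: int ^ 'n. \<exists>y. (lattice_adj ^^ Suc m) (y + d) y} \<subseteq> (\<lambda>(d, e). d - e) ` (?S \<times> lattice_dirs)"
  proof (intro subsetI)
    fix d :: "int ^ 'n" assume "d \<in> {d. \<exists>y. (lattice_adj ^^ Suc m) (y + d) y}"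
    then obtain y where "(lattice_adj ^^ Suc m) (y + d) y" by blast
    then obtain z where z: "lattice_adj (y + d) z" "(lattice_adj ^^ m) z y"
      by (meson relpowp_Suc_E2)
    have "(lattice_adj ^^ m) (y + (z - y)) y" using z(2) by simp
    then have "(z - y, z - (y + d)) \<in> ?S \<times> lattice_dirs"
      using z(1) unfolding lattice_adj_iff_dirs by blast
    moreover have "d = (\<lambda>(d, e). d - e) (z - y, z - (y + d))" by simp
    ultimately show "d \<in> (\<lambda>(d, e). d - e) ` (?S \<times> lattice_dirs)" by blast
  qed
  then show ?case using Suc by (meson finite_SigmaI finite_imageI finite_lattice_dirs finite_subset)
qed

lemma finite_lattice_ball: "finite {d :: int ^ 'n. \<exists>y. lattice_dist (y + d) y < m}"
proof -
  have "{d :: int ^ 'n. \<exists>y. lattice_dist (y + d) y < m}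
          \<subseteq> (\<Union>k<m. {d. \<exists>y. (lattice_adj ^^ k) (y + d) y})"
  proof
    fix d :: "int ^ 'n" assume "d \<in> {d. \<exists>y. lattice_dist (y + d) y < m}"
    then obtain y where y: "lattice_dist (y + d) y < m" by blast
    have "(lattice_adj ^^ lattice_dist (y + d) y) (y + d) y"
      unfolding lattice_dist_def using lattice_connected by (rule LeastI_ex)
    then show "d \<in> (\<Union>k<m. {d. \<exists>y. (lattice_adj ^^ k) (y + d) y})" using y by blast
  qed
  then show ?thesis by (rule finite_subset) (simp add: finite_lattice_sphere)
qed

lemma finite_not_eventually_lattice_at_infinity:
  assumes "eventually P (lattice_at_infinity :: (int ^ 'n) filter)"
  shows "finite {x. \<not> P x}"
proof -
  obtain m where m: "\<And>x. lattice_dist x 0 \<ge> m \<Longrightarrow> P x"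
    using assms by (auto simp: lattice_at_infinity_def eventually_filtercomap eventually_at_top_linorder)
  have "{x. \<not> P x} \<subseteq> {d. \<exists>y. lattice_dist (y + d) y < m}"
  proof
    fix x assume "x \<in> {x. \<not> P x}"
    then have "lattice_dist (0 + x) 0 < m" using m[of x] by fastforce
    then show "x \<in> {d. \<exists>y. lattice_dist (y + d) y < m}" by blast
  qed
  then show ?thesis using finite_lattice_ball finite_subset by blast
qed

text \<open>This encodes divergence of the distance without mentioning a distance. Its negation
  directly yields a subsequence along which the difference is constant.\<close>

definition drifts_apart :: "(nat \<Rightarrow> int ^ 'n) \<Rightarrow> (nat \<Rightarrow> int ^ 'n) \<Rightarrow> bool" where
  "drifts_apart y z \<longleftrightarrow> (\<forall>d. eventually (\<lambda>n. y n - z n \<noteq> d) sequentially)"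

lemma drifts_apart_finite:
  assumes "drifts_apart y z" "finite F"
  shows "eventually (\<lambda>n. y n - z n \<notin> F) sequentially"
proof -
  have "eventually (\<lambda>n. \<forall>d\<in>F. y n - z n \<noteq> d) sequentially"
    using assms by (intro eventually_ball_finite) (auto simp: drifts_apart_def)
  then show ?thesis by (rule eventually_mono) blast
qed

lemma drifts_apart_sym: "drifts_apart y z \<Longrightarrow> drifts_apart z y"
  unfolding drifts_apart_def
proof (intro allI)
  fix d assume "\<forall>d. eventually (\<lambda>n. y n - z n \<noteq> d) sequentially"
  then have "eventually (\<lambda>n. y n - z n \<noteq> - d) sequentially" by blast
  then show "eventually (\<lambda>n. z n - y n \<noteq> d) sequentially"
    by (rule eventually_mono) (metis minus_diff_eq)
qed

lemma filterlim_lattice_dist: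
  assumes "drifts_apart y z"
  shows "filterlim (\<lambda>n. lattice_dist (y n) (z n)) at_top sequentially"
  unfolding filterlim_at_top
proof
  fix m
  show "eventually (\<lambda>n. m \<le> lattice_dist (y n) (z n)) sequentially"
    using drifts_apart_finite[OF assms finite_lattice_ball[of m]]
  proof (rule eventually_mono)
    fix n assume "y n - z n \<notin> {d. \<exists>y. lattice_dist (y + d) y < m}"
    then have "\<not> lattice_dist (z n + (y n - z n)) (z n) < m" by blast
    then show "m \<le> lattice_dist (y n) (z n)" by simp
  qed
qed

lemma drifts_apart_compose:
  assumes "drifts_apart y z" "filterlim r sequentially sequentially"
  shows "drifts_apart (\<lambda>n. y (r n)) (\<lambda>n. z (r n))"
  unfolding drifts_apart_def
proof
  fix d
  have "eventually (\<lambda>n. y n - z n \<noteq> d) sequentially" using assms(1) by (simp add: drifts_apart_def)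
  from eventually_compose_filterlim[OF this assms(2)]
  show "eventually (\<lambda>n. y (r n) - z (r n) \<noteq> d) sequentially" .
qed

text \<open>A bubble seen from a frame that drifts away from its centre: the argument of U leaves
  the finite set where |U| \<ge> \<epsilon>.\<close>

lemma drifts_apart_tendsto_0:
  fixes U :: "int ^ 'n \<Rightarrow> real"
  assumes "drifts_apart y z" and fin: "\<And>\<epsilon>. \<epsilon> > 0 \<Longrightarrow> finite {x. \<bar>U x\<bar> \<ge> \<epsilon>}"
  shows "(\<lambda>n. U (x + z n - y n)) \<longlonglongrightarrow> 0"
proof (rule tendstoI)
  fix \<epsilon> :: real assume "\<epsilon> > 0"
  then have "finite ((\<lambda>t. x - t) ` {x. \<bar>U x\<bar> \<ge> \<epsilon>})" using fin by simp
  from drifts_apart_finite[OF assms(1) this]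
  show "eventually (\<lambda>n. dist (U (x + z n - y n)) 0 < \<epsilon>) sequentially"
  proof (rule eventually_mono)
    fix n assume n: "y n - z n \<notin> (\<lambda>t. x - t) ` {x. \<bar>U x\<bar> \<ge> \<epsilon>}"
    have "y n - z n = x - (x + z n - y n)" by simp
    then have "\<not> \<bar>U (x + z n - y n)\<bar> \<ge> \<epsilon>" using n by blast
    then show "dist (U (x + z n - y n)) 0 < \<epsilon>" by simp
  qed
qed

subsection \<open>The gradient\<close>

abbreviation grad_sq :: "(int ^ 'n \<Rightarrow> real) \<Rightarrow> int ^ 'n \<Rightarrow> real" where
  "grad_sq u \<equiv> grad_prod u u"

lemma grad_prod_eq:
  "grad_prod u v x = (1 / 2) * (\<Sum>e\<in>lattice_dirs. (u (x + e) - u x) * (v (x + e) - v x))"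
  unfolding grad_prod_def neighbours_eq by (simp add: sum.reindex)

lemma grad_prod_commute: "grad_prod u v = grad_prod v u"
  by (simp add: fun_eq_iff grad_prod_eq mult.commute)

lemma grad_prod_add_left: "grad_prod (\<lambda>x. u x + v x) w x = grad_prod u w x + grad_prod v w x"
  unfolding grad_prod_eq distrib_left[symmetric] sum.distrib[symmetric]
  by (intro arg_cong[where f="\<lambda>t. 1 / 2 * t"] sum.cong refl) (simp add: algebra_simps)

lemma grad_prod_cmult_left: "grad_prod (\<lambda>x. c * u x) v x = c * grad_prod u v x"
  unfolding grad_prod_eq sum_distrib_left
  by (intro sum.cong refl) (simp add: algebra_simps)

lemma grad_prod_cmult_right: "grad_prod u (\<lambda>x. c * v x) x = c * grad_prod u v x"
  unfolding grad_prod_eq sum_distrib_left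
  by (intro sum.cong refl) (simp add: algebra_simps)

lemma grad_prod_translate: "grad_prod (\<lambda>x. u (x + z)) (\<lambda>x. v (x + z)) x = grad_prod u v (x + z)"
  by (simp add: grad_prod_eq add.assoc add.commute[of z])

lemma grad_sq_nonneg [simp]: "grad_sq u x \<ge> 0"
  unfolding grad_prod_eq by (intro mult_nonneg_nonneg[of "1 / 2"] sum_nonneg zero_le_square) simp

lemma grad_sq_mono:
  assumes "\<And>x y. \<bar>u x - u y\<bar> \<le> \<bar>v x - v y\<bar>"
  shows "grad_sq u x \<le> grad_sq v x"
proof -
  have "(u (x + e) - u x) * (u (x + e) - u x) \<le> (v (x + e) - v x) * (v (x + e) - v x)" for e
    using iffD1[OF abs_le_square_iff assms[of "x + e" x]] unfolding power2_eq_square .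
  then show ?thesis unfolding grad_prod_eq by (intro mult_left_mono sum_mono) auto
qed

lemma grad_prod_tendsto:
  assumes "\<And>x. (\<lambda>n. u n x) \<longlonglongrightarrow> a x" "\<And>x. (\<lambda>n. v n x) \<longlonglongrightarrow> b x"
  shows "(\<lambda>n. grad_prod (u n) (v n) x) \<longlonglongrightarrow> grad_prod a b x"
proof -
  have "(\<lambda>n. (u n (x + e) - u n x) * (v n (x + e) - v n x))
      \<longlonglongrightarrow> (a (x + e) - a x) * (b (x + e) - b x)" for e
    by (rule tendsto_mult[OF tendsto_diff[OF assms(1) assms(1)] tendsto_diff[OF assms(2) assms(2)]])
  then show ?thesis unfolding grad_prod_eq by (rule tendsto_mult_left[OF tendsto_sum])
qed

text \<open>Provides the majorant for dominated convergence when u moves and v is fixed.\<close>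

lemma grad_prod_young:
  assumes "\<eta> > 0"
  shows "\<bar>grad_prod u v x\<bar> \<le> \<eta> * grad_sq u x + (1 / \<eta>) * grad_sq v x"
proof -
  have *: "\<bar>s * t\<bar> \<le> \<eta> * (s * s) + (1 / \<eta>) * (t * t)" for s t :: real
  proof -
    have "0 \<le> (\<eta> * \<bar>s\<bar> - \<bar>t\<bar>)\<^sup>2" by simp
    then have "2 * \<eta> * \<bar>s * t\<bar> \<le> \<eta> * (\<eta> * (s * s)) + t * t"
      by (simp add: power2_diff power2_eq_square abs_mult algebra_simps)
    then have "\<eta> * (2 * \<bar>s * t\<bar>) \<le> \<eta> * (\<eta> * (s * s) + (1 / \<eta>) * (t * t))"
      using assms by (simp add: algebra_simps)
    then have "2 * \<bar>s * t\<bar> \<le> \<eta> * (s * s) + (1 / \<eta>) * (t * t)" using assms by simp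
    then show ?thesis by linarith
  qed
  let ?s = "\<lambda>e. u (x + e) - u x" and ?t = "\<lambda>e. v (x + e) - v x"
  have "\<bar>\<Sum>e\<in>lattice_dirs. ?s e * ?t e\<bar> \<le> (\<Sum>e\<in>lattice_dirs. \<bar>?s e * ?t e\<bar>)" by (rule sum_abs)
  also have "\<dots> \<le> (\<Sum>e\<in>lattice_dirs. \<eta> * (?s e * ?s e) + (1 / \<eta>) * (?t e * ?t e))"
    by (rule sum_mono) (rule *)
  also have "\<dots> = \<eta> * (\<Sum>e\<in>lattice_dirs. ?s e * ?s e) + (1 / \<eta>) * (\<Sum>e\<in>lattice_dirs. ?t e * ?t e)"
    by (simp add: sum.distrib sum_distrib_left)
  finally show ?thesis by (simp add: grad_prod_eq abs_mult)
qed

lemma grad_sq_add: "grad_sq (\<lambda>x. u x + v x) x = grad_sq u x + grad_sq v x + 2 * grad_prod u v x"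
proof -
  have "grad_prod w (\<lambda>x. u x + v x) x = grad_prod w u x + grad_prod w v x" for w
    using grad_prod_add_left[of u v w x] unfolding grad_prod_commute[of u w] grad_prod_commute[of v w]
    by (subst grad_prod_commute)
  then show ?thesis using fun_cong[OF grad_prod_commute[of u v], of x] by (simp add: grad_prod_add_left)
qed

lemma abs_diff_le_grad_sq:
  assumes "e \<in> lattice_dirs"
  shows "(u (x + e) - u x)\<^sup>2 \<le> 2 * grad_sq u x"
proof -
  have "(u (x + e) - u x) * (u (x + e) - u x)
      \<le> (\<Sum>e\<in>lattice_dirs. (u (x + e) - u x) * (u (x + e) - u x))"
    using assms by (intro member_le_sum) auto
  then show ?thesis by (simp add: grad_prod_eq power2_eq_square)
qed

subsection \<open>The energy space\<close>

text \<open>The s-th power of the l^s norm; powers are kept because they, not norms, split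
  additively in the limit.\<close>

definition powr_sum :: "real \<Rightarrow> ('a \<Rightarrow> real) \<Rightarrow> real" where
  "powr_sum s u = (\<Sum>\<^sub>\<infinity>x. \<bar>u x\<bar> powr s)"

definition dirichlet :: "(int ^ 'n \<Rightarrow> real) \<Rightarrow> real" where
  "dirichlet u = (\<Sum>\<^sub>\<infinity>x. grad_sq u x)"

text \<open>The working form of membership in the energy space, justified by
  \<open>E_space_eq\<close>; summability of the q-th powers follows from that of the p-th
  powers.\<close>

definition in_E :: "real \<Rightarrow> (int ^ 'n \<Rightarrow> real) \<Rightarrow> bool" where
  "in_E p u \<longleftrightarrow> grad_sq u summable_on UNIV \<and> (\<lambda>x. \<bar>u x\<bar> powr p) summable_on UNIV"

lemma in_E_grad: "in_E p u \<Longrightarrow> grad_sq u summable_on UNIV"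
  and in_E_powr: "in_E p u \<Longrightarrow> (\<lambda>x. \<bar>u x\<bar> powr p) summable_on UNIV"
  by (auto simp: in_E_def)

lemma powr_sum_nonneg [simp]: "powr_sum s u \<ge> 0"
  unfolding powr_sum_def by (rule infsum_nonneg) simp

lemma dirichlet_nonneg [simp]: "dirichlet u \<ge> 0"
  unfolding dirichlet_def by (rule infsum_nonneg) simp

lemma powr_le_powr_sum:
  "(\<lambda>x. \<bar>u x\<bar> powr s) summable_on UNIV \<Longrightarrow> \<bar>u x\<bar> powr s \<le> powr_sum s u"
  unfolding powr_sum_def by (rule le_infsum_real) auto

lemma abs_le_powr_sum:
  assumes "(\<lambda>x. \<bar>u x\<bar> powr s) summable_on UNIV" "s > 0"
  shows "\<bar>u x\<bar> \<le> powr_sum s u powr (1 / s)"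
proof -
  have "(\<bar>u x\<bar> powr s) powr (1 / s) \<le> powr_sum s u powr (1 / s)"
    using powr_le_powr_sum[OF assms(1)] assms(2) by (intro powr_mono2) auto
  then show ?thesis using assms(2) by (simp add: powr_powr)
qed

text \<open>The source both of the embedding of l^p into l^q and of the smallness of q-sums of
  uniformly small functions.\<close>

lemma powr_le_sup_powr:
  fixes t B p q :: real
  assumes "\<bar>t\<bar> \<le> B" "p \<le> q"
  shows "\<bar>t\<bar> powr q \<le> B powr (q - p) * \<bar>t\<bar> powr p"
proof -
  have "\<bar>t\<bar> powr q = \<bar>t\<bar> powr (q - p) * \<bar>t\<bar> powr p" by (simp flip: powr_add)
  also have "\<dots> \<le> B powr (q - p) * \<bar>t\<bar> powr p"
    using assms by (intro mult_right_mono powr_mono2) auto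
  finally show ?thesis .
qed

lemma
  assumes "(\<lambda>x. \<bar>u x\<bar> powr p) summable_on UNIV" "p \<le> q" "\<And>x. \<bar>u x\<bar> \<le> B"
  shows summable_powr_mono: "(\<lambda>x. \<bar>u x\<bar> powr q) summable_on UNIV"
    and powr_sum_le: "powr_sum q u \<le> B powr (q - p) * powr_sum p u"
proof -
  have sB: "(\<lambda>x. B powr (q - p) * \<bar>u x\<bar> powr p) summable_on UNIV"
    using assms(1) by (rule summable_on_cmult_right)
  show s: "(\<lambda>x. \<bar>u x\<bar> powr q) summable_on UNIV"
    by (rule summable_on_real_comparison[OF sB]) (use powr_le_sup_powr assms in auto)
  have "powr_sum q u \<le> (\<Sum>\<^sub>\<infinity>x. B powr (q - p) * \<bar>u x\<bar> powr p)"
    unfolding powr_sum_def by (rule infsum_mono[OF s sB]) (use powr_le_sup_powr assms in auto)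
  then show "powr_sum q u \<le> B powr (q - p) * powr_sum p u"
    by (simp add: powr_sum_def infsum_cmult_right')
qed

lemma in_E_powr':
  assumes "in_E p u" "0 < p" "p \<le> q"
  shows "(\<lambda>x. \<bar>u x\<bar> powr q) summable_on UNIV"
  by (rule summable_powr_mono[OF in_E_powr[OF assms(1)] assms(3)],
      rule abs_le_powr_sum[OF in_E_powr[OF assms(1)] assms(2)])

lemma powr_sum_le_powr_sum:
  assumes "in_E p u" "0 < p" "p \<le> q"
  shows "powr_sum q u \<le> (powr_sum p u powr (1 / p)) powr (q - p) * powr_sum p u"
  by (rule powr_sum_le[OF in_E_powr[OF assms(1)] assms(3)],
      rule abs_le_powr_sum[OF in_E_powr[OF assms(1)] assms(2)])

lemma powr_sum_bound:
  assumes "in_E p u" "0 < p" "p \<le> q" "powr_sum p u \<le> M"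
  shows "powr_sum q u \<le> (M powr (1 / p)) powr (q - p) * M"
proof -
  have "(powr_sum p u powr (1 / p)) powr (q - p) * powr_sum p u \<le> (M powr (1 / p)) powr (q - p) * M"
    using assms by (intro mult_mono powr_mono2) auto
  with powr_sum_le_powr_sum[OF assms(1-3)] show ?thesis by linarith
qed

text \<open>Chebyshev: every point of the level set contributes at least \<epsilon>^s to a finite
  sum.\<close>

lemma finite_level_set:
  fixes u :: "'a \<Rightarrow> real" and s \<epsilon> :: real
  assumes "(\<lambda>x. \<bar>u x\<bar> powr s) summable_on UNIV" "s > 0" "\<epsilon> > 0"
  shows "finite {x. \<bar>u x\<bar> \<ge> \<epsilon>}"
proof (rule ccontr)
  assume inf: "infinite {x. \<bar>u x\<bar> \<ge> \<epsilon>}"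
  obtain m :: nat where m: "powr_sum s u < m * \<epsilon> powr s"
    using reals_Archimedean3[of "\<epsilon> powr s"] assms(3) by (metis powr_gt_zero less_irrefl)
  obtain F where F: "finite F" "card F = m" "F \<subseteq> {x. \<bar>u x\<bar> \<ge> \<epsilon>}"
    using infinite_arbitrarily_large[OF inf] by blast
  have "m * \<epsilon> powr s = (\<Sum>x\<in>F. \<epsilon> powr s)" using F by simp
  also have "\<dots> \<le> (\<Sum>x\<in>F. \<bar>u x\<bar> powr s)"
    using F assms by (intro sum_mono powr_mono2) auto
  also have "\<dots> \<le> powr_sum s u"
    unfolding powr_sum_def by (rule finite_sum_le_infsum[OF assms(1)]) (use F in auto)
  finally show False using m by simp
qed

lemma grad_prod_summable:
  assumes "in_E p u" "in_E p v"
  shows "grad_prod u v summable_on UNIV"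
proof (rule summable_on_real_comparison)
  show "(\<lambda>x. grad_sq u x + grad_sq v x) summable_on UNIV"
    by (intro summable_on_add in_E_grad[OF assms(1)] in_E_grad[OF assms(2)])
  show "\<bar>grad_prod u v x\<bar> \<le> grad_sq u x + grad_sq v x" for x
    using grad_prod_young[of 1 u v x] by simp
qed

lemma grad_sq_cmult: "grad_sq (\<lambda>x. c * u x) = (\<lambda>x. c\<^sup>2 * grad_sq u x)"
  by (rule ext) (simp add: grad_prod_cmult_left grad_prod_cmult_right power2_eq_square)

lemma abs_cmult_powr: "\<bar>c * t\<bar> powr s = \<bar>c\<bar> powr s * \<bar>t\<bar> powr s" for c t s :: real
  by (simp add: abs_mult powr_mult)

lemma in_E_cmult: "in_E p u \<Longrightarrow> in_E p (\<lambda>x. c * u x)"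
  unfolding in_E_def grad_sq_cmult abs_cmult_powr by (auto intro: summable_on_cmult_right)

lemma dirichlet_cmult: "dirichlet (\<lambda>x. c * u x) = c\<^sup>2 * dirichlet u"
  unfolding dirichlet_def grad_sq_cmult by (rule infsum_cmult_right')

lemma powr_sum_cmult: "powr_sum s (\<lambda>x. c * u x) = \<bar>c\<bar> powr s * powr_sum s u"
  unfolding powr_sum_def abs_cmult_powr by (rule infsum_cmult_right')

lemma grad_sq_add_le: "grad_sq (\<lambda>x. u x + v x) x \<le> 2 * grad_sq u x + 2 * grad_sq v x"
proof -
  have "0 \<le> grad_sq (\<lambda>x. u x + (-1) * v x) x" by simp
  also have "\<dots> = grad_sq u x + grad_sq v x - 2 * grad_prod u v x"
    unfolding grad_sq_add grad_prod_cmult_left grad_prod_cmult_right by simp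
  finally show ?thesis unfolding grad_sq_add by linarith
qed

lemma
  assumes "in_E p u" "in_E p v" "p \<ge> 0"
  shows in_E_add: "in_E p (\<lambda>x. u x + v x)"
    and dirichlet_add_le: "dirichlet (\<lambda>x. u x + v x) \<le> 2 * dirichlet u + 2 * dirichlet v"
    and powr_sum_add_le: "powr_sum p (\<lambda>x. u x + v x) \<le> 2 powr p * (powr_sum p u + powr_sum p v)"
proof -
  note su = assms(1)[unfolded in_E_def] and sv = assms(2)[unfolded in_E_def]
  have g2: "(\<lambda>x. 2 * grad_sq u x) summable_on UNIV" "(\<lambda>x. 2 * grad_sq v x) summable_on UNIV"
    using su sv by (auto intro: summable_on_cmult_right)
  have p2: "(\<lambda>x. \<bar>u x\<bar> powr p + \<bar>v x\<bar> powr p) summable_on UNIV"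
    using su sv by (auto intro: summable_on_add)
  then have p3: "(\<lambda>x. 2 powr p * (\<bar>u x\<bar> powr p + \<bar>v x\<bar> powr p)) summable_on UNIV"
    by (rule summable_on_cmult_right)
  have sg: "grad_sq (\<lambda>x. u x + v x) summable_on UNIV"
    by (rule summable_on_real_comparison[OF summable_on_add[OF g2]]) (simp add: grad_sq_add_le)
  have sp: "(\<lambda>x. \<bar>u x + v x\<bar> powr p) summable_on UNIV"
    by (rule summable_on_real_comparison[OF p3]) (simp add: abs_add_powr_le assms(3))
  from sg sp show "in_E p (\<lambda>x. u x + v x)" by (simp add: in_E_def)
  have "dirichlet (\<lambda>x. u x + v x) \<le> (\<Sum>\<^sub>\<infinity>x. 2 * grad_sq u x + 2 * grad_sq v x)"
    unfolding dirichlet_def by (rule infsum_mono[OF sg summable_on_add[OF g2]]) (rule grad_sq_add_le)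
  also have "\<dots> = 2 * dirichlet u + 2 * dirichlet v"
    unfolding dirichlet_def infsum_add[OF g2] by (simp add: infsum_cmult_right')
  finally show "dirichlet (\<lambda>x. u x + v x) \<le> 2 * dirichlet u + 2 * dirichlet v" .
  have "powr_sum p (\<lambda>x. u x + v x) \<le> (\<Sum>\<^sub>\<infinity>x. 2 powr p * (\<bar>u x\<bar> powr p + \<bar>v x\<bar> powr p))"
    unfolding powr_sum_def by (rule infsum_mono[OF sp p3]) (rule abs_add_powr_le[OF assms(3)])
  also have "\<dots> = 2 powr p * (powr_sum p u + powr_sum p v)"
    unfolding powr_sum_def infsum_cmult_right'
    using infsum_add[OF in_E_powr[OF assms(1)] in_E_powr[OF assms(2)]] by simp
  finally show "powr_sum p (\<lambda>x. u x + v x) \<le> 2 powr p * (powr_sum p u + powr_sum p v)" .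
qed

section \<open>Translation invariance of the sums\<close>

lemma bij_translate: "bij_betw (\<lambda>x. x + z) UNIV (UNIV :: (int ^ 'n) set)"
  by (rule bij_betwI[of _ _ _ "\<lambda>x. x - z"]) auto

lemma in_E_translate: "in_E p (\<lambda>x. u (x + z)) \<longleftrightarrow> in_E p u"
  unfolding in_E_def grad_prod_translate
  using summable_on_reindex_bij_betw[OF bij_translate, of "grad_sq u" z]
    summable_on_reindex_bij_betw[OF bij_translate, of "\<lambda>x. \<bar>u x\<bar> powr p" z]
  by simp

lemma infsum_translate: "(\<Sum>\<^sub>\<infinity>x. f (x + z)) = (\<Sum>\<^sub>\<infinity>x. f x)" for z :: "int ^ 'n"
  by (rule infsum_reindex_bij_betw[OF bij_translate])

lemma dirichlet_translate: "dirichlet (\<lambda>x. u (x + z)) = dirichlet u"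
  unfolding dirichlet_def grad_prod_translate by (rule infsum_translate)

lemma powr_sum_translate: "powr_sum s (\<lambda>x. u (x + z)) = powr_sum s u" for z :: "int ^ 'n"
  unfolding powr_sum_def by (rule infsum_translate)

lemma in_E_finitely_supported:
  assumes "\<phi> \<in> finitely_supported"
  shows "in_E p \<phi>"
proof -
  let ?S = "{x. \<phi> x \<noteq> 0}"
  have S: "finite ?S" using assms by (simp add: finitely_supported_def)
  \<comment> \<open>The support together with its neighbours; the gradient vanishes
    elsewhere.\<close>
  let ?T = "?S \<union> (\<Union>e\<in>lattice_dirs. (\<lambda>x. x - e) ` ?S)"
  have "finite ?T" using S by simp
  moreover have "grad_sq \<phi> x = 0" if "x \<notin> ?T" for x
  proof -
    have "\<phi> x = 0" using that by blast
    moreover have "\<phi> (x + e) = 0" if "e \<in> lattice_dirs" for e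
    proof (rule ccontr)
      assume "\<phi> (x + e) \<noteq> 0"
      then have "(x + e) - e \<in> (\<lambda>x. x - e) ` ?S" by blast
      then show False using \<open>x \<notin> ?T\<close> that by simp
    qed
    ultimately show ?thesis by (simp add: grad_prod_eq)
  qed
  ultimately have "grad_sq \<phi> summable_on UNIV \<longleftrightarrow> grad_sq \<phi> summable_on ?T"
    by (intro summable_on_cong_neutral) auto
  with \<open>finite ?T\<close> have 1: "grad_sq \<phi> summable_on UNIV" by simp
  have "(\<lambda>x. \<bar>\<phi> x\<bar> powr p) summable_on UNIV \<longleftrightarrow> (\<lambda>x. \<bar>\<phi> x\<bar> powr p) summable_on ?S"
    by (rule summable_on_cong_neutral) auto
  with S have "(\<lambda>x. \<bar>\<phi> x\<bar> powr p) summable_on UNIV" by simp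
  with 1 show ?thesis by (simp add: in_E_def)
qed

lemma grad_abs_powr_2: "\<bar>grad_abs u x\<bar> powr 2 = grad_sq u x"
  by (simp add: grad_abs_def)

lemma lp_finite_grad_abs: "lp_finite 2 (grad_abs u) \<longleftrightarrow> grad_sq u summable_on UNIV"
  by (simp add: lp_finite_def grad_abs_powr_2)

lemma E_norm_eq:
  "E_norm p q u = dirichlet u powr (1 / 2) + powr_sum p u powr (1 / p) + powr_sum q u powr (1 / q)"
  by (simp add: E_norm_def lp_norm_def grad_abs_powr_2 dirichlet_def powr_sum_def)

lemma E_norm_cmult:
  assumes "p > 0" "q > 0"
  shows "E_norm p q (\<lambda>x. c * u x) = \<bar>c\<bar> * E_norm p q u"
proof -
  have "(c\<^sup>2) powr (1 / 2) = \<bar>c\<bar>" by (simp add: powr_half_sqrt)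
  then show ?thesis using assms
    by (simp add: E_norm_eq dirichlet_cmult powr_sum_cmult powr_mult powr_powr algebra_simps)
qed

lemma E_norm_tendsto_0:
  assumes "0 < p" "p \<le> q" "\<And>n. in_E p (w n)"
    "(\<lambda>n. dirichlet (w n)) \<longlonglongrightarrow> 0" "(\<lambda>n. powr_sum p (w n)) \<longlonglongrightarrow> 0"
  shows "(\<lambda>n. E_norm p q (w n)) \<longlonglongrightarrow> 0"
proof -
  have z: "(\<lambda>n. f n powr c) \<longlonglongrightarrow> 0" if "f \<longlonglongrightarrow> 0" "c > 0" "\<And>n. f n \<ge> 0" for f :: "nat \<Rightarrow> real" and c
    using that by (intro tendsto_zero_powrI[of f _ "\<lambda>_. c" c]) auto
  have q0: "(\<lambda>n. powr_sum q (w n)) \<longlonglongrightarrow> 0"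
  \<comment> \<open>The auxiliary fact \<open>z\<close> asks for a positive exponent, and q - p is
    one only for p < q.\<close>
  proof (cases "p = q")
    case True then show ?thesis using assms by simp
  next
    case False
    have "(\<lambda>n. (powr_sum p (w n) powr (1 / p)) powr (q - p) * powr_sum p (w n)) \<longlonglongrightarrow> 0 * 0"
      using assms False by (intro tendsto_mult z) auto
    then show ?thesis
      by (intro tendsto_sandwich[OF _ _ tendsto_const, of 0 "\<lambda>n. powr_sum q (w n)"])
        (use assms in \<open>auto intro!: powr_sum_le_powr_sum always_eventually\<close>)
  qed
  have "(\<lambda>n. E_norm p q (w n)) \<longlonglongrightarrow> 0 + 0 + 0"
    unfolding E_norm_eq using assms q0 by (intro tendsto_add z) auto
  then show ?thesis by simp
qed

text \<open>The approximants are the soft thresholds \<open>u - clamp u\<close>: they vanish off the finite set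
  \<open>{x. \<bar>u x\<bar> > \<epsilon>}\<close>, and clamping is 1-Lipschitz, so the gradient of the error is
  dominated by that of \<open>u\<close>. (For \<open>p > 2\<close> a plain spatial cutoff is problematic, since \<open>u\<close> need not
  be square summable.)\<close>

lemma in_E_imp_E_space:
  fixes u :: "int ^ 'n \<Rightarrow> real"
  assumes "in_E p u" "0 < p" "p \<le> q"
  shows "u \<in> E_space p q"
proof -
  define w where "w m x = max (- (1 / Suc m)) (min (1 / Suc m) (u x))" for m :: nat and x
  have wu: "\<bar>w m x\<bar> \<le> \<bar>u x\<bar>" and we: "\<bar>w m x\<bar> \<le> 1 / Suc m" for m x
    by (auto simp: w_def max_def min_def abs_if)
  have wl: "\<bar>w m x - w m y\<bar> \<le> \<bar>u x - u y\<bar>" for m x y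
    by (auto simp: w_def max_def min_def abs_if)
  have wg: "grad_sq (w m) x \<le> grad_sq u x" for m x
    by (rule grad_sq_mono) (rule wl)
  have w0: "(\<lambda>m. w m x) \<longlonglongrightarrow> 0" for x
    by (rule Lim_null_comparison[OF _ lim_inverse_n'[THEN LIMSEQ_Suc]])
      (use we in \<open>auto simp: inverse_eq_divide\<close>)
  have wp: "\<bar>w m x\<bar> powr p \<le> \<bar>u x\<bar> powr p" for m x
    using wu assms by (intro powr_mono2) auto
  have wE: "in_E p (w m)" for m
    unfolding in_E_def
    using summable_on_real_comparison[OF in_E_grad[OF assms(1)], of "grad_sq (w m)"]
      summable_on_real_comparison[OF in_E_powr[OF assms(1)], of "\<lambda>x. \<bar>w m x\<bar> powr p"]
    using wg wp by simp
  have "(\<lambda>m. \<bar>w m x\<bar> powr p) \<longlonglongrightarrow> 0" for x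
    using w0[of x] assms(2)
    by (intro tendsto_zero_powrI[of _ _ "\<lambda>_. p" p]) (auto intro: tendsto_rabs_zero)
  \<comment> \<open>Plain dominated convergence with majorant |u|^p: the moving part is
    zero.\<close>
  then have "(\<lambda>m. powr_sum p (w m)) \<longlonglongrightarrow> 0"
    unfolding powr_sum_def
    by (rule infsum_tendsto_0_almost_dominated[where w = "\<lambda>_ _. 0" and M = 0])
      (use in_E_powr[OF assms(1)] wp in auto)
  moreover have "(\<lambda>m. grad_sq (w m) x) \<longlonglongrightarrow> 0" for x
  proof -
    have "grad_sq (\<lambda>_ :: int ^ 'n. 0 :: real) x = 0" by (simp add: grad_prod_eq)
    moreover have "(\<lambda>m. grad_sq (w m) x) \<longlonglongrightarrow> grad_sq (\<lambda>_. 0) x"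
      by (rule grad_prod_tendsto) (rule w0)+
    ultimately show ?thesis by simp
  qed
  then have "(\<lambda>m. dirichlet (w m)) \<longlonglongrightarrow> 0"
    unfolding dirichlet_def
    by (rule infsum_tendsto_0_almost_dominated[where w = "\<lambda>_ _. 0" and M = 0])
      (use in_E_grad[OF assms(1)] wg in auto)
  ultimately have "(\<lambda>m. E_norm p q (w m)) \<longlonglongrightarrow> 0"
    using wE assms by (intro E_norm_tendsto_0) auto
  moreover have "(\<lambda>x. u x - w m x) \<in> finitely_supported" for m
  proof -
    have "{x. u x - w m x \<noteq> 0} \<subseteq> {x. \<bar>u x\<bar> \<ge> 1 / Suc m}"
      by (auto simp: w_def max_def min_def abs_if split: if_splits)
    moreover have "finite {x. \<bar>u x\<bar> \<ge> 1 / Suc m}"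
      by (rule finite_level_set[OF in_E_powr[OF assms(1)] assms(2)]) simp
    ultimately show ?thesis by (simp add: finitely_supported_def finite_subset)
  qed
  ultimately have "\<exists>\<phi>. (\<forall>m::nat. \<phi> m \<in> finitely_supported) \<and>
      (\<lambda>m. E_norm p q (\<lambda>x. u x - \<phi> m x)) \<longlonglongrightarrow> 0"
    by (intro exI[of _ "\<lambda>m x. u x - w m x"]) simp
  then show ?thesis
    using in_E_powr'[OF assms] assms(1)
    unfolding E_space_def lp_finite_grad_abs by (simp add: lp_finite_def in_E_def)
qed

text \<open>Soft thresholding shows that finitely supported functions are dense among all functions
  with finite Dirichlet and l^p sums.\<close>

lemma E_space_eq:
  assumes "0 < p" "p \<le> q"
  shows "E_space p q = {u. in_E p u}"
  using in_E_imp_E_space[OF _ assms]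
  by (auto simp: E_space_def lp_finite_grad_abs in_E_def lp_finite_def[of p])

subsection \<open>Brezis-Lieb splitting\<close>

text \<open>Convergence to 0 along the cofinite filter. It is applied both to functions of the
  energy space and to the defects \<open>a x - abar\<close> of the coefficients.\<close>

definition vanishes :: "('a \<Rightarrow> real) \<Rightarrow> bool" where
  "vanishes u \<longleftrightarrow> (\<forall>\<epsilon>>0. finite {x. \<bar>u x\<bar> \<ge> \<epsilon>})"

lemma vanishes_bounded:
  assumes "vanishes u"
  shows "\<exists>B\<ge>0. \<forall>x. \<bar>u x\<bar> \<le> B"
proof -
  have fin: "finite ((\<lambda>x. \<bar>u x\<bar>) ` {x. \<bar>u x\<bar> \<ge> 1})" using assms by (simp add: vanishes_def)
  then obtain B where B: "\<And>x. \<bar>u x\<bar> \<ge> 1 \<Longrightarrow> \<bar>u x\<bar> \<le> B"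
    using bdd_above_finite[OF fin] by (auto simp: bdd_above_def)
  have "\<bar>u x\<bar> \<le> max B 1" for x using B[of x] by (cases "\<bar>u x\<bar> \<ge> 1") auto
  then show ?thesis by (intro exI[of _ "max B 1"]) auto
qed

lemma vanishes_diff_bounded:
  assumes "vanishes (\<lambda>x. a x - abar)"
  shows "\<exists>B\<ge>0. \<forall>x. \<bar>a x\<bar> \<le> B"
proof -
  obtain B where "B \<ge> 0" "\<And>x. \<bar>a x - abar\<bar> \<le> B" using vanishes_bounded[OF assms] by blast
  then have "\<bar>a x\<bar> \<le> B + \<bar>abar\<bar>" for x using abs_triangle_ineq[of "a x - abar" abar] by (metis add_le_cancel_right diff_add_cancel order_trans)
  then show ?thesis using \<open>B \<ge> 0\<close> by (intro exI[of _ "B + \<bar>abar\<bar>"]) auto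
qed

text \<open>Makes the limit functional a special case of \<Phi>, so that one splitting lemma serves
  the first limit and all bubbles.\<close>

lemma vanishes_const [simp]: "vanishes (\<lambda>x. abar - abar)"
  by (simp add: vanishes_def)

lemma in_E_vanishes:
  assumes "in_E p u" "p > 0"
  shows "vanishes u"
  unfolding vanishes_def using finite_level_set[OF in_E_powr[OF assms(1)] assms(2)] by blast

text \<open>The common core of the splittings of the energy (F = |t|^s, \<psi> = 1) and of its
  derivative (F = \<open>sgn_powr s\<close>, \<psi> a moving test function). Adding and subtracting
  a F(v) \<psi> leaves three terms: \<open>near\<close> and \<open>small\<close> control those with
  the increment of F and with F(w), while (a - abar) F(v) \<psi> is small against W off a finite
  set.\<close>

lemma splitting:
  fixes v \<psi> W :: "nat \<Rightarrow> 'a \<Rightarrow> real"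
  assumes a: "vanishes (\<lambda>x. a x - abar)"
    and F: "continuous_on UNIV F" "F 0 = 0"
    and v: "\<And>x. (\<lambda>n. v n x) \<longlonglongrightarrow> 0"
    and \<psi>: "\<And>x. \<exists>B. \<forall>n. \<bar>\<psi> n x\<bar> \<le> B"
    and near: "\<And>\<eta>. \<eta> > 0 \<Longrightarrow> \<exists>C\<ge>0. \<forall>n x. \<bar>F (v n x + w x) - F (v n x)\<bar> * \<bar>\<psi> n x\<bar> \<le> \<eta> * W n x + C * g x"
    and small: "\<And>\<eta>. \<eta> > 0 \<Longrightarrow> \<exists>C\<ge>0. \<forall>n x. \<bar>F (w x)\<bar> * \<bar>\<psi> n x\<bar> \<le> \<eta> * W n x + C * g x"
    and big: "\<And>n x. \<bar>F (v n x)\<bar> * \<bar>\<psi> n x\<bar> \<le> W n x"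
    and W: "\<And>n. W n summable_on UNIV" "\<And>n x. W n x \<ge> 0" "\<And>n. infsum (W n) UNIV \<le> M"
    and g: "g summable_on UNIV" "\<And>x. g x \<ge> 0"
  shows "(\<lambda>n. \<Sum>\<^sub>\<infinity>x. a x * (F (v n x + w x) * \<psi> n x) - abar * (F (v n x) * \<psi> n x)
              - a x * (F (w x) * \<psi> n x)) \<longlonglongrightarrow> 0"
proof (rule infsum_tendsto_0_almost_dominated[where w = W and M = M])
  show "W n summable_on UNIV" "W n x \<ge> 0" "infsum (W n) UNIV \<le> M" for n x by (rule W)+
next
  fix x
  obtain B where B: "\<And>n. \<bar>\<psi> n x\<bar> \<le> B" using \<psi> by blast
  have Fc: "(\<lambda>n. F (z n)) \<longlonglongrightarrow> F l" if "z \<longlonglongrightarrow> l" for z l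
    using continuous_on_tendsto_compose[OF F(1) that] by simp
  let ?d = "\<lambda>n. a x * F (v n x + w x) - abar * F (v n x) - a x * F (w x)"
  have "?d \<longlonglongrightarrow> a x * F (0 + w x) - abar * F 0 - a x * F (w x)"
    by (rule tendsto_diff[OF tendsto_diff[OF tendsto_mult_left[OF Fc] tendsto_mult_left[OF Fc]] tendsto_const])
      (intro tendsto_add v tendsto_const)+
  then have d: "?d \<longlonglongrightarrow> 0" by (simp add: F(2))
  have "(\<lambda>n. ?d n * \<psi> n x) \<longlonglongrightarrow> 0"
  proof (rule Lim_null_comparison)
    show "eventually (\<lambda>n. norm (?d n * \<psi> n x) \<le> \<bar>?d n\<bar> * B) sequentially"
      using B by (auto simp: abs_mult intro!: always_eventually mult_left_mono)
    show "(\<lambda>n. \<bar>?d n\<bar> * B) \<longlonglongrightarrow> 0"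
      using tendsto_mult_right[OF tendsto_rabs_zero[OF d], of B] by simp
  qed
  then show "(\<lambda>n. a x * (F (v n x + w x) * \<psi> n x) - abar * (F (v n x) * \<psi> n x)
              - a x * (F (w x) * \<psi> n x)) \<longlonglongrightarrow> 0"
    by (simp add: algebra_simps)
next
  fix \<eta> :: real assume "\<eta> > 0"
  obtain A where A: "A \<ge> 0" "\<And>x. \<bar>a x\<bar> \<le> A" using vanishes_diff_bounded[OF a] by blast
  \<comment> \<open>The factor 2 A + 1 counts A from \<open>near\<close>, A from
    \<open>small\<close> and 1 from the defect a - abar.\<close>
  define \<eta>' where "\<eta>' = \<eta> / (2 * A + 1)"
  have \<eta>': "\<eta>' > 0" "(2 * A + 1) * \<eta>' = \<eta>" using \<open>\<eta> > 0\<close> A by (auto simp: \<eta>'_def field_simps)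
  obtain C1 where C1: "C1 \<ge> 0"
    "\<And>n x. \<bar>F (v n x + w x) - F (v n x)\<bar> * \<bar>\<psi> n x\<bar> \<le> \<eta>' * W n x + C1 * g x"
    using near[OF \<eta>'(1)] by blast
  obtain C2 where C2: "C2 \<ge> 0"
    "\<And>n x. \<bar>F (w x)\<bar> * \<bar>\<psi> n x\<bar> \<le> \<eta>' * W n x + C2 * g x"
    using small[OF \<eta>'(1)] by blast
  let ?K = "{x. \<bar>a x - abar\<bar> \<ge> \<eta>'}"
  have K: "finite ?K" using a \<eta>'(1) by (simp add: vanishes_def)
  \<comment> \<open>Where a is not yet close to abar, the crude bound W \<le> M is used; there are
    finitely many such points, so the bound is summable.\<close>
  define k where "k x = (if x \<in> ?K then (A + \<bar>abar\<bar>) * M else 0)" for x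
  have "k summable_on UNIV \<longleftrightarrow> k summable_on ?K"
    by (rule summable_on_cong_neutral) (auto simp: k_def)
  then have k: "k summable_on UNIV" using K by simp
  define G where "G x = A * (C1 + C2) * g x + k x" for x
  have "G summable_on UNIV"
    unfolding G_def using g k by (intro summable_on_add summable_on_cmult_right)
  moreover have "\<bar>a x * (F (v n x + w x) * \<psi> n x) - abar * (F (v n x) * \<psi> n x)
      - a x * (F (w x) * \<psi> n x)\<bar> \<le> \<eta> * W n x + G x" for n x
  proof -
    let ?P = "\<bar>F (v n x + w x) - F (v n x)\<bar> * \<bar>\<psi> n x\<bar>"
    let ?Q = "\<bar>F (v n x)\<bar> * \<bar>\<psi> n x\<bar>" and ?R = "\<bar>F (w x)\<bar> * \<bar>\<psi> n x\<bar>"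
    have h1: "a x * (F (v n x + w x) * \<psi> n x) - abar * (F (v n x) * \<psi> n x) - a x * (F (w x) * \<psi> n x)
      = a x * ((F (v n x + w x) - F (v n x)) * \<psi> n x) + (a x - abar) * (F (v n x) * \<psi> n x)
        - a x * (F (w x) * \<psi> n x)" by (simp add: algebra_simps)
    have h2: "\<bar>a x * (F (v n x + w x) * \<psi> n x) - abar * (F (v n x) * \<psi> n x) - a x * (F (w x) * \<psi> n x)\<bar>
        \<le> \<bar>a x\<bar> * ?P + \<bar>a x - abar\<bar> * ?Q + \<bar>a x\<bar> * ?R"
      unfolding h1 abs_mult[symmetric] by linarith
    have h3: "\<bar>a x\<bar> * ?P \<le> A * (\<eta>' * W n x + C1 * g x)"
      using A C1(2)[of n x] by (intro mult_mono) auto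
    have h4: "\<bar>a x\<bar> * ?R \<le> A * (\<eta>' * W n x + C2 * g x)"
      using A C2(2)[of x n] by (intro mult_mono) auto
    have h5: "\<bar>a x - abar\<bar> * ?Q \<le> \<eta>' * W n x + k x"
    proof (cases "x \<in> ?K")
      case False
      then have "\<bar>a x - abar\<bar> * ?Q \<le> \<eta>' * W n x" using big by (intro mult_mono) auto
      then show ?thesis using False by (simp add: k_def)
    next
      case True
      have "W n x \<le> M" using le_infsum_real[OF W(1,2)] W(3) order_trans by blast
      then have "?Q \<le> M" using big order_trans by blast
      moreover have "\<bar>a x - abar\<bar> \<le> A + \<bar>abar\<bar>" using A(2)[of x] by linarith
      ultimately have "\<bar>a x - abar\<bar> * ?Q \<le> (A + \<bar>abar\<bar>) * M" using A(1) by (intro mult_mono) auto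
      then show ?thesis using True \<eta>'(1) W(2)[of n x] by (simp add: k_def add_increasing)
    qed
    have "\<bar>a x * (F (v n x + w x) * \<psi> n x) - abar * (F (v n x) * \<psi> n x) - a x * (F (w x) * \<psi> n x)\<bar>
      \<le> A * (\<eta>' * W n x + C1 * g x) + (\<eta>' * W n x + k x) + A * (\<eta>' * W n x + C2 * g x)"
      using h2 h3 h4 h5 by linarith
    also have "\<dots> = ((2 * A + 1) * \<eta>') * W n x + G x" by (simp add: G_def algebra_simps)
    finally show ?thesis unfolding \<eta>'(2) .
  qed
  ultimately show "\<exists>g. g summable_on UNIV \<and> (\<forall>n x. \<bar>a x * (F (v n x + w x) * \<psi> n x)
      - abar * (F (v n x) * \<psi> n x) - a x * (F (w x) * \<psi> n x)\<bar> \<le> \<eta> * W n x + g x)" by blast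
qed

lemma summable_bounded_mult:
  fixes a f :: "'a \<Rightarrow> real"
  assumes "\<And>x. \<bar>a x\<bar> \<le> A" "f summable_on UNIV"
  shows "(\<lambda>x. a x * f x) summable_on UNIV"
proof (rule summable_on_real_comparison)
  show "(\<lambda>x. A * \<bar>f x\<bar>) summable_on UNIV"
    using assms(2) summable_on_iff_abs_summable_on_real[of f UNIV] by (auto intro: summable_on_cmult_right)
  show "\<bar>a x * f x\<bar> \<le> A * \<bar>f x\<bar>" for x
    using assms(1)[of x] by (simp add: abs_mult mult_right_mono)
qed

lemma summable_add_powr:
  fixes u v :: "'a \<Rightarrow> real"
  assumes "s \<ge> 0" "(\<lambda>x. \<bar>u x\<bar> powr s) summable_on UNIV" "(\<lambda>x. \<bar>v x\<bar> powr s) summable_on UNIV"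
  shows "(\<lambda>x. \<bar>u x + v x\<bar> powr s) summable_on UNIV"
proof (rule summable_on_real_comparison)
  show "(\<lambda>x. 2 powr s * (\<bar>u x\<bar> powr s + \<bar>v x\<bar> powr s)) summable_on UNIV"
    by (intro summable_on_cmult_right summable_on_add assms)
qed (simp add: abs_add_powr_le assms(1))

lemma sgn_powr_mult_le:
  assumes "s > 1"
  shows "\<bar>sgn_powr s t\<bar> * \<bar>r\<bar> \<le> \<bar>t\<bar> powr s + \<bar>r\<bar> powr s"
  using young_powr[of 1 s "\<bar>t\<bar>" "\<bar>r\<bar>"] assms by (simp add: abs_sgn_powr add.commute)

lemma summable_sgn_powr_mult:
  fixes u \<phi> :: "'a \<Rightarrow> real"
  assumes "s > 1" "(\<lambda>x. \<bar>u x\<bar> powr s) summable_on UNIV" "(\<lambda>x. \<bar>\<phi> x\<bar> powr s) summable_on UNIV"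
  shows "(\<lambda>x. sgn_powr s (u x) * \<phi> x) summable_on UNIV"
  by (rule summable_on_real_comparison[OF summable_on_add[OF assms(2,3)]])
    (simp add: abs_mult sgn_powr_mult_le assms(1))

text \<open>The Brezis-Lieb lemma with a coefficient: as v tends to 0 on every finite set, it only
  sees the value of a at infinity.\<close>

lemma powr_splitting:
  fixes v :: "nat \<Rightarrow> 'a \<Rightarrow> real"
  assumes s: "s > 1" and a: "vanishes (\<lambda>x. a x - abar)"
    and v: "\<And>x. (\<lambda>n. v n x) \<longlonglongrightarrow> 0"
    and vs: "\<And>n. (\<lambda>x. \<bar>v n x\<bar> powr s) summable_on UNIV" "\<And>n. powr_sum s (v n) \<le> M"
    and ws: "(\<lambda>x. \<bar>w x\<bar> powr s) summable_on UNIV"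
  shows "(\<lambda>n. (\<Sum>\<^sub>\<infinity>x. a x * \<bar>v n x + w x\<bar> powr s) - (\<Sum>\<^sub>\<infinity>x. abar * \<bar>v n x\<bar> powr s)
              - (\<Sum>\<^sub>\<infinity>x. a x * \<bar>w x\<bar> powr s)) \<longlonglongrightarrow> 0"
proof -
  obtain A where A: "\<And>x. \<bar>a x\<bar> \<le> A" using vanishes_diff_bounded[OF a] by blast
  have "(\<lambda>n. \<Sum>\<^sub>\<infinity>x. a x * (\<bar>v n x + w x\<bar> powr s * 1) - abar * (\<bar>v n x\<bar> powr s * 1)
              - a x * (\<bar>w x\<bar> powr s * 1)) \<longlonglongrightarrow> 0"
  proof (rule splitting[where F = "\<lambda>t. \<bar>t\<bar> powr s" and \<psi> = "\<lambda>_ _. 1" and W = "\<lambda>n x. \<bar>v n x\<bar> powr s"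
        and g = "\<lambda>x. \<bar>w x\<bar> powr s" and M = M, OF a])
    show "continuous_on UNIV (\<lambda>t::real. \<bar>t\<bar> powr s)" using s by (simp add: continuous_abs_powr)
    show "\<exists>C\<ge>0. \<forall>n x. \<bar>\<bar>v n x + w x\<bar> powr s - \<bar>v n x\<bar> powr s\<bar> * \<bar>1\<bar>
            \<le> \<eta> * \<bar>v n x\<bar> powr s + C * \<bar>w x\<bar> powr s" if "\<eta> > 0" for \<eta>
    proof -
      have "\<exists>C\<ge>0. \<forall>r t. \<bar>\<bar>r + t\<bar> powr s - \<bar>r\<bar> powr s\<bar> \<le> \<eta> * \<bar>r\<bar> powr s + C * \<bar>t\<bar> powr s"
        using s that by (intro homogeneous_perturbation continuous_abs_powr abs_powr_homogeneous) auto
      then show ?thesis by auto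
    qed
    show "\<exists>C\<ge>0. \<forall>n x. \<bar>\<bar>w x\<bar> powr s\<bar> * \<bar>1\<bar> \<le> \<eta> * \<bar>v n x\<bar> powr s + C * \<bar>w x\<bar> powr s" if "\<eta> > 0" for \<eta>
      using that by (intro exI[of _ 1]) auto
  qed (use assms in \<open>auto simp: powr_sum_def\<close>)
  moreover have "(\<Sum>\<^sub>\<infinity>x. a x * \<bar>v n x + w x\<bar> powr s - abar * \<bar>v n x\<bar> powr s - a x * \<bar>w x\<bar> powr s)
      = (\<Sum>\<^sub>\<infinity>x. a x * \<bar>v n x + w x\<bar> powr s) - (\<Sum>\<^sub>\<infinity>x. abar * \<bar>v n x\<bar> powr s)
              - (\<Sum>\<^sub>\<infinity>x. a x * \<bar>w x\<bar> powr s)" for n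
  proof -
    have 1: "(\<lambda>x. a x * \<bar>v n x + w x\<bar> powr s) summable_on UNIV"
      using s by (intro summable_bounded_mult[OF A] summable_add_powr vs ws) auto
    have 2: "(\<lambda>x. abar * \<bar>v n x\<bar> powr s) summable_on UNIV"
      by (intro summable_on_cmult_right vs)
    have 3: "(\<lambda>x. a x * \<bar>w x\<bar> powr s) summable_on UNIV" by (intro summable_bounded_mult[OF A] ws)
    show ?thesis
      using infsum_diff_real[OF summable_diff_real[OF 1 2] 3] infsum_diff_real[OF 1 2] by simp
  qed
  ultimately show ?thesis by simp
qed

text \<open>The test functions are merely bounded and need not converge, so Young's inequality
  places their powers in the moving part W, next to |v|^s; hence the bound 2 M.\<close>

lemma sgn_powr_splitting:
  fixes v \<phi> :: "nat \<Rightarrow> 'a \<Rightarrow> real"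
  assumes s: "s > 1" and a: "vanishes (\<lambda>x. a x - abar)"
    and v: "\<And>x. (\<lambda>n. v n x) \<longlonglongrightarrow> 0"
    and vs: "\<And>n. (\<lambda>x. \<bar>v n x\<bar> powr s) summable_on UNIV" "\<And>n. powr_sum s (v n) \<le> M"
    and \<phi>s: "\<And>n. (\<lambda>x. \<bar>\<phi> n x\<bar> powr s) summable_on UNIV" "\<And>n. powr_sum s (\<phi> n) \<le> M"
    and ws: "(\<lambda>x. \<bar>w x\<bar> powr s) summable_on UNIV"
  shows "(\<lambda>n. (\<Sum>\<^sub>\<infinity>x. a x * (sgn_powr s (v n x + w x) * \<phi> n x)) - (\<Sum>\<^sub>\<infinity>x. abar * (sgn_powr s (v n x) * \<phi> n x))
              - (\<Sum>\<^sub>\<infinity>x. a x * (sgn_powr s (w x) * \<phi> n x))) \<longlonglongrightarrow> 0"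
proof -
  obtain A where A: "\<And>x. \<bar>a x\<bar> \<le> A" using vanishes_diff_bounded[OF a] by blast
  have small: "\<exists>C\<ge>0. \<forall>n x. \<bar>w x\<bar> powr (s - 1) * \<bar>\<phi> n x\<bar>
            \<le> \<eta> * (\<bar>v n x\<bar> powr s + \<bar>\<phi> n x\<bar> powr s) + C * \<bar>w x\<bar> powr s" if \<eta>: "\<eta> > 0" for \<eta>
  proof -
    obtain C where C: "C \<ge> 0" "\<And>T Y::real. \<lbrakk>T \<ge> 0; Y \<ge> 0\<rbrakk> \<Longrightarrow> T powr (s - 1) * Y \<le> \<eta> * Y powr s + C * T powr s"
      using young_powr_small[OF \<eta> s] by blast
    have "\<bar>w x\<bar> powr (s - 1) * \<bar>\<phi> n x\<bar>
            \<le> \<eta> * (\<bar>v n x\<bar> powr s + \<bar>\<phi> n x\<bar> powr s) + C * \<bar>w x\<bar> powr s" for n x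
      using C(2)[of "\<bar>w x\<bar>" "\<bar>\<phi> n x\<bar>"] mult_nonneg_nonneg[of \<eta> "\<bar>v n x\<bar> powr s"] \<eta>
      unfolding distrib_left by (smt (verit) abs_ge_zero powr_ge_zero)
    then show ?thesis using C(1) by blast
  qed
  have "(\<lambda>n. \<Sum>\<^sub>\<infinity>x. a x * (sgn_powr s (v n x + w x) * \<phi> n x) - abar * (sgn_powr s (v n x) * \<phi> n x)
              - a x * (sgn_powr s (w x) * \<phi> n x)) \<longlonglongrightarrow> 0"
  proof (rule splitting[where F = "sgn_powr s" and \<psi> = \<phi> and W = "\<lambda>n x. \<bar>v n x\<bar> powr s + \<bar>\<phi> n x\<bar> powr s"
        and g = "\<lambda>x. \<bar>w x\<bar> powr s" and M = "2 * M", OF a])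
    show "continuous_on UNIV (sgn_powr s)" using s by (rule continuous_sgn_powr)
    show "\<exists>B. \<forall>n. \<bar>\<phi> n x\<bar> \<le> B" for x
    proof (intro exI allI)
      fix n
      have "\<bar>\<phi> n x\<bar> \<le> powr_sum s (\<phi> n) powr (1 / s)" using abs_le_powr_sum[OF \<phi>s(1)] s by simp
      also have "\<dots> \<le> M powr (1 / s)" using s \<phi>s(2) by (intro powr_mono2) auto
      finally show "\<bar>\<phi> n x\<bar> \<le> M powr (1 / s)" .
    qed
    show "\<exists>C\<ge>0. \<forall>n x. \<bar>sgn_powr s (v n x + w x) - sgn_powr s (v n x)\<bar> * \<bar>\<phi> n x\<bar>
            \<le> \<eta> * (\<bar>v n x\<bar> powr s + \<bar>\<phi> n x\<bar> powr s) + C * \<bar>w x\<bar> powr s" if \<eta>: "\<eta> > 0" for \<eta>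
    proof -
      obtain C where C: "C \<ge> 0" "\<And>r t. \<bar>sgn_powr s (r + t) - sgn_powr s r\<bar>
          \<le> (\<eta> / 2) * \<bar>r\<bar> powr (s - 1) + C * \<bar>t\<bar> powr (s - 1)"
        using homogeneous_perturbation[OF continuous_sgn_powr[OF s] _ sgn_powr_homogeneous[of _ s], of "\<eta> / 2"] s \<eta> by auto
      \<comment> \<open>The term C |w|^(s-1) |\<phi>| needs a second use of Young's inequality, with
        C \<eta>' \<le> \<eta>/2 also when C = 0.\<close>
      define \<eta>' where "\<eta>' = \<eta> / (2 * (C + 1))"
      have \<eta>': "\<eta>' > 0" "C * \<eta>' \<le> \<eta> / 2" using \<eta> C(1) by (auto simp: \<eta>'_def field_simps)
      obtain C' where C': "C' \<ge> 0" "\<And>n x. \<bar>w x\<bar> powr (s - 1) * \<bar>\<phi> n x\<bar>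
            \<le> \<eta>' * (\<bar>v n x\<bar> powr s + \<bar>\<phi> n x\<bar> powr s) + C' * \<bar>w x\<bar> powr s"
        using small[OF \<eta>'(1)] by blast
      have "\<bar>sgn_powr s (v n x + w x) - sgn_powr s (v n x)\<bar> * \<bar>\<phi> n x\<bar>
            \<le> \<eta> * (\<bar>v n x\<bar> powr s + \<bar>\<phi> n x\<bar> powr s) + (C * C') * \<bar>w x\<bar> powr s" for n x
      proof -
        let ?W = "\<bar>v n x\<bar> powr s + \<bar>\<phi> n x\<bar> powr s"
        have h1: "\<bar>sgn_powr s (v n x + w x) - sgn_powr s (v n x)\<bar> * \<bar>\<phi> n x\<bar>
            \<le> ((\<eta> / 2) * \<bar>v n x\<bar> powr (s - 1) + C * \<bar>w x\<bar> powr (s - 1)) * \<bar>\<phi> n x\<bar>"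
          by (rule mult_right_mono[OF C(2)]) simp
        have h2: "((\<eta> / 2) * \<bar>v n x\<bar> powr (s - 1) + C * \<bar>w x\<bar> powr (s - 1)) * \<bar>\<phi> n x\<bar> = (\<eta> / 2) * (\<bar>v n x\<bar> powr (s - 1) * \<bar>\<phi> n x\<bar>) + C * (\<bar>w x\<bar> powr (s - 1) * \<bar>\<phi> n x\<bar>)"
          by (simp add: algebra_simps)
        have "\<bar>v n x\<bar> powr (s - 1) * \<bar>\<phi> n x\<bar> \<le> ?W"
          using sgn_powr_mult_le[OF s] by (simp add: abs_sgn_powr)
        then have h3: "(\<eta> / 2) * (\<bar>v n x\<bar> powr (s - 1) * \<bar>\<phi> n x\<bar>) \<le> (\<eta> / 2) * ?W"
          using \<eta> by (intro mult_left_mono) auto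
        have h4: "C * (\<bar>w x\<bar> powr (s - 1) * \<bar>\<phi> n x\<bar>) \<le> C * (\<eta>' * ?W + C' * \<bar>w x\<bar> powr s)"
          by (rule mult_left_mono[OF C'(2) C(1)])
        have h5: "C * (\<eta>' * ?W + C' * \<bar>w x\<bar> powr s) = (C * \<eta>') * ?W + (C * C') * \<bar>w x\<bar> powr s"
          by (simp add: algebra_simps)
        have h6: "(C * \<eta>') * ?W \<le> (\<eta> / 2) * ?W"
          by (rule mult_right_mono[OF \<eta>'(2)]) simp
        show ?thesis using h1 h2 h3 h4 h5 h6 unfolding distrib_left by linarith
      qed
      then show ?thesis using C(1) C'(1) by (intro exI[of _ "C * C'"]) auto
    qed
    show "\<exists>C\<ge>0. \<forall>n x. \<bar>sgn_powr s (w x)\<bar> * \<bar>\<phi> n x\<bar>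
            \<le> \<eta> * (\<bar>v n x\<bar> powr s + \<bar>\<phi> n x\<bar> powr s) + C * \<bar>w x\<bar> powr s" if "\<eta> > 0" for \<eta>
      using small[OF that] by (simp add: abs_sgn_powr)
    show "\<bar>sgn_powr s (v n x)\<bar> * \<bar>\<phi> n x\<bar> \<le> \<bar>v n x\<bar> powr s + \<bar>\<phi> n x\<bar> powr s" for n x
      by (rule sgn_powr_mult_le[OF s])
    show "(\<lambda>x. \<bar>v n x\<bar> powr s + \<bar>\<phi> n x\<bar> powr s) summable_on UNIV" for n
      by (intro summable_on_add vs \<phi>s)
    show "(\<Sum>\<^sub>\<infinity>x. \<bar>v n x\<bar> powr s + \<bar>\<phi> n x\<bar> powr s) \<le> 2 * M" for n
      using infsum_add[OF vs(1) \<phi>s(1), of n n] vs(2)[of n] \<phi>s(2)[of n] by (simp add: powr_sum_def)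
  qed (use v ws in auto)
  moreover have "(\<Sum>\<^sub>\<infinity>x. a x * (sgn_powr s (v n x + w x) * \<phi> n x) - abar * (sgn_powr s (v n x) * \<phi> n x)
              - a x * (sgn_powr s (w x) * \<phi> n x))
      = (\<Sum>\<^sub>\<infinity>x. a x * (sgn_powr s (v n x + w x) * \<phi> n x)) - (\<Sum>\<^sub>\<infinity>x. abar * (sgn_powr s (v n x) * \<phi> n x))
              - (\<Sum>\<^sub>\<infinity>x. a x * (sgn_powr s (w x) * \<phi> n x))" for n
  proof -
    have 1: "(\<lambda>x. a x * (sgn_powr s (v n x + w x) * \<phi> n x)) summable_on UNIV"
      using s by (intro summable_bounded_mult[OF A] summable_sgn_powr_mult summable_add_powr vs ws \<phi>s) auto
    have 2: "(\<lambda>x. abar * (sgn_powr s (v n x) * \<phi> n x)) summable_on UNIV"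
      by (intro summable_on_cmult_right summable_sgn_powr_mult s vs \<phi>s)
    have 3: "(\<lambda>x. a x * (sgn_powr s (w x) * \<phi> n x)) summable_on UNIV"
      by (intro summable_bounded_mult[OF A] summable_sgn_powr_mult s ws \<phi>s)
    show ?thesis
      using infsum_diff_real[OF summable_diff_real[OF 1 2] 3] infsum_diff_real[OF 1 2] by simp
  qed
  ultimately show ?thesis by simp
qed

text \<open>With \<phi> fixed, Young's inequality is used the other way round: \<eta> goes to the
  moving |v|^s and the large constant to |\<phi>|^s.\<close>

lemma sgn_powr_mult_tendsto_0:
  fixes v :: "nat \<Rightarrow> 'a \<Rightarrow> real"
  assumes s: "s > 1" and v: "\<And>x. (\<lambda>n. v n x) \<longlonglongrightarrow> 0"
    and vs: "\<And>n. (\<lambda>x. \<bar>v n x\<bar> powr s) summable_on UNIV" "\<And>n. powr_sum s (v n) \<le> M"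
    and \<phi>s: "(\<lambda>x. \<bar>\<phi> x\<bar> powr s) summable_on UNIV"
  shows "(\<lambda>n. \<Sum>\<^sub>\<infinity>x. sgn_powr s (v n x) * \<phi> x) \<longlonglongrightarrow> 0"
proof (rule infsum_tendsto_0_almost_dominated[where w = "\<lambda>n x. \<bar>v n x\<bar> powr s" and M = M])
  show "(\<lambda>n. sgn_powr s (v n x) * \<phi> x) \<longlonglongrightarrow> 0" for x
    using tendsto_mult_right[OF continuous_on_tendsto_compose[OF continuous_sgn_powr[OF s] v[of x]], of "\<phi> x"] by simp
  show "\<exists>g. g summable_on UNIV \<and> (\<forall>n x. \<bar>sgn_powr s (v n x) * \<phi> x\<bar> \<le> \<eta> * \<bar>v n x\<bar> powr s + g x)" if "\<eta> > 0" for \<eta>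
  proof (intro exI conjI allI)
    show "(\<lambda>x. \<eta> powr (1 - s) * \<bar>\<phi> x\<bar> powr s) summable_on UNIV" by (intro summable_on_cmult_right \<phi>s)
    show "\<bar>sgn_powr s (v n x) * \<phi> x\<bar> \<le> \<eta> * \<bar>v n x\<bar> powr s + \<eta> powr (1 - s) * \<bar>\<phi> x\<bar> powr s" for n x
      using young_powr[of \<eta> s "\<bar>v n x\<bar>" "\<bar>\<phi> x\<bar>"] that s by (simp add: abs_mult abs_sgn_powr)
  qed
qed (use vs in \<open>auto simp: powr_sum_def\<close>)

text \<open>Bounded Dirichlet sums turn pointwise convergence into weak convergence of
  gradients.\<close>

lemma grad_prod_tendsto_0:
  assumes v: "\<And>x. (\<lambda>n. v n x) \<longlonglongrightarrow> 0" and vg: "\<And>n. grad_sq (v n) summable_on UNIV" "\<And>n. dirichlet (v n) \<le> M"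
    and \<phi>: "grad_sq \<phi> summable_on UNIV"
  shows "(\<lambda>n. \<Sum>\<^sub>\<infinity>x. grad_prod (v n) \<phi> x) \<longlonglongrightarrow> 0"
proof (rule infsum_tendsto_0_almost_dominated[where w = "\<lambda>n. grad_sq (v n)" and M = M])
  show "(\<lambda>n. grad_prod (v n) \<phi> x) \<longlonglongrightarrow> 0" for x
  proof -
    have "grad_prod (\<lambda>_. 0) \<phi> x = 0" by (simp add: grad_prod_eq)
    moreover have "(\<lambda>n. grad_prod (v n) \<phi> x) \<longlonglongrightarrow> grad_prod (\<lambda>_. 0) \<phi> x"
      by (rule grad_prod_tendsto) (rule v tendsto_const)+
    ultimately show ?thesis by simp
  qed
  show "\<exists>g. g summable_on UNIV \<and> (\<forall>n x. \<bar>grad_prod (v n) \<phi> x\<bar> \<le> \<eta> * grad_sq (v n) x + g x)" if "\<eta> > 0" for \<eta>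
    using grad_prod_young[OF that] by (intro exI[of _ "\<lambda>x. (1 / \<eta>) * grad_sq \<phi> x"] conjI summable_on_cmult_right \<phi>) auto
qed (use vg in \<open>auto simp: dirichlet_def\<close>)

subsection \<open>Palais-Smale sequences and their weak limits\<close>

lemma energy_eq:
  "energy p q a b u = (1 / 2) * dirichlet u + (1 / p) * (\<Sum>\<^sub>\<infinity>x. a x * \<bar>u x\<bar> powr p)
     - (1 / q) * (\<Sum>\<^sub>\<infinity>x. b x * \<bar>u x\<bar> powr q)"
  by (simp add: energy_def dirichlet_def grad_abs_def)

lemma energy_deriv_eq:
  "energy_deriv p q a b u \<phi> = (\<Sum>\<^sub>\<infinity>x. grad_prod u \<phi> x)
     + (\<Sum>\<^sub>\<infinity>x. a x * (sgn_powr p (u x) * \<phi> x)) - (\<Sum>\<^sub>\<infinity>x. b x * (sgn_powr q (u x) * \<phi> x))"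
  by (simp add: energy_deriv_def sgn_powr_def mult.assoc)

lemma energy_deriv_self:
  "energy_deriv p q a b u u = dirichlet u + (\<Sum>\<^sub>\<infinity>x. a x * \<bar>u x\<bar> powr p) - (\<Sum>\<^sub>\<infinity>x. b x * \<bar>u x\<bar> powr q)"
  by (simp add: energy_deriv_eq sgn_powr_mult_self dirichlet_def)

lemma energy_deriv_cmult: "energy_deriv p q a b u (\<lambda>x. c * \<phi> x) = c * energy_deriv p q a b u \<phi>"
proof -
  have *: "t * (r * (c * z)) = c * (t * (r * z))" for t r z :: real by simp
  show ?thesis
    unfolding energy_deriv_eq grad_prod_cmult_right * infsum_cmult_right' by (simp add: algebra_simps)
qed

definition E_bounded :: "real \<Rightarrow> (nat \<Rightarrow> int ^ 'n \<Rightarrow> real) \<Rightarrow> bool" where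
  "E_bounded p u \<longleftrightarrow> (\<exists>M. \<forall>n. in_E p (u n) \<and> dirichlet (u n) \<le> M \<and> powr_sum p (u n) \<le> M)"

lemma E_bounded_in_E: "E_bounded p u \<Longrightarrow> in_E p (u n)"
  by (auto simp: E_bounded_def)

lemma E_bounded_const: "in_E p u \<Longrightarrow> E_bounded p (\<lambda>_. u)"
  unfolding E_bounded_def by (intro exI[of _ "max (dirichlet u) (powr_sum p u)"]) auto

lemma E_bounded_add:
  assumes "E_bounded p u" "E_bounded p v" "p \<ge> 0"
  shows "E_bounded p (\<lambda>n x. u n x + v n x)"
proof -
  obtain M where M: "\<And>n. in_E p (u n) \<and> dirichlet (u n) \<le> M \<and> powr_sum p (u n) \<le> M"
    using assms(1) by (auto simp: E_bounded_def)
  obtain M' where M': "\<And>n. in_E p (v n) \<and> dirichlet (v n) \<le> M' \<and> powr_sum p (v n) \<le> M'"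
    using assms(2) by (auto simp: E_bounded_def)
  show ?thesis unfolding E_bounded_def
  proof (intro exI allI conjI)
    fix n
    note uv = conjunct1[OF M[of n]] conjunct1[OF M'[of n]] assms(3)
    show "in_E p (\<lambda>x. u n x + v n x)" by (rule in_E_add[OF uv])
    have "dirichlet (\<lambda>x. u n x + v n x) \<le> 2 * M + 2 * M'"
      using dirichlet_add_le[OF uv] M[of n] M'[of n] by linarith
    then show "dirichlet (\<lambda>x. u n x + v n x) \<le> max (2 * M + 2 * M') (2 powr p * (M + M'))" by simp
    have "powr_sum p (\<lambda>x. u n x + v n x) \<le> 2 powr p * (powr_sum p (u n) + powr_sum p (v n))"
      by (rule powr_sum_add_le[OF uv])
    also have "\<dots> \<le> 2 powr p * (M + M')" using M[of n] M'[of n] by (intro mult_left_mono) auto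
    finally show "powr_sum p (\<lambda>x. u n x + v n x) \<le> max (2 * M + 2 * M') (2 powr p * (M + M'))" by simp
  qed
qed

lemma E_bounded_diff:
  assumes "E_bounded p u" "E_bounded p v" "p \<ge> 0"
  shows "E_bounded p (\<lambda>n x. u n x - v n x)"
proof -
  have "E_bounded p (\<lambda>n x. (-1) * v n x)"
    using assms(2) in_E_cmult[of p _ "-1"]
    unfolding E_bounded_def dirichlet_cmult powr_sum_cmult by fastforce
  from E_bounded_add[OF assms(1) this assms(3)] show ?thesis by simp
qed

lemma E_bounded_compose: "E_bounded p u \<Longrightarrow> E_bounded p (\<lambda>n. u (r n))"
  unfolding E_bounded_def by blast

lemma E_bounded_translate: "E_bounded p u \<Longrightarrow> E_bounded p (\<lambda>n x. u n (x + y n))"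
  unfolding E_bounded_def by (simp add: in_E_translate dirichlet_translate powr_sum_translate)

lemma E_bounded_powr_sum:
  assumes "E_bounded p u" "0 < p" "p \<le> q"
  obtains M where "\<And>n. powr_sum q (u n) \<le> M"
  using assms powr_sum_bound unfolding E_bounded_def by blast

lemma E_bounded_abs_le:
  assumes "E_bounded p u" "0 < p"
  obtains M where "\<And>n x. \<bar>u n x\<bar> \<le> M"
proof -
  obtain M where M: "\<And>n. in_E p (u n) \<and> dirichlet (u n) \<le> M \<and> powr_sum p (u n) \<le> M"
    using assms(1) by (auto simp: E_bounded_def)
  have "\<bar>u n x\<bar> \<le> M powr (1 / p)" for n x
  proof -
    have "\<bar>u n x\<bar> \<le> powr_sum p (u n) powr (1 / p)"
      using M[of n] by (intro abs_le_powr_sum[OF in_E_powr assms(2)]) auto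
    also have "\<dots> \<le> M powr (1 / p)" using M[of n] assms(2) by (intro powr_mono2) auto
    finally show ?thesis .
  qed
  then show ?thesis by (rule that)
qed

text \<open>Fatou's lemma, by passing to the limit in finite partial sums.\<close>

lemma infsum_limit_bounded:
  fixes f :: "nat \<Rightarrow> 'a \<Rightarrow> real"
  assumes "\<And>n. f n summable_on UNIV" "\<And>n x. f n x \<ge> 0" "\<And>n. infsum (f n) UNIV \<le> M"
    and lim: "\<And>x. (\<lambda>n. f n x) \<longlonglongrightarrow> g x"
  shows "g summable_on UNIV"
proof (rule nonneg_bdd_above_summable_on)
  show "g x \<ge> 0" for x using LIMSEQ_le_const[OF lim] assms(2) by blast
  show "bdd_above (sum g ` {F. F \<subseteq> UNIV \<and> finite F})"
  proof (rule bdd_aboveI2)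
    fix F :: "'a set" assume "F \<in> {F. F \<subseteq> UNIV \<and> finite F}"
    then have F: "finite F" by simp
    have "sum (f n) F \<le> M" for n
      using finite_sum_le_infsum[OF assms(1) F, of n] assms(2,3) order_trans by blast
    moreover have "(\<lambda>n. sum (f n) F) \<longlonglongrightarrow> sum g F" by (rule tendsto_sum) (rule lim)
    ultimately show "sum g F \<le> M" using LIMSEQ_le_const2 by blast
  qed
qed

lemma E_bounded_limit_in_E:
  assumes "E_bounded p u" "0 < p" and lim: "\<And>x. (\<lambda>n. u n x) \<longlonglongrightarrow> w x"
  shows "in_E p w"
proof -
  obtain M where M: "\<And>n. in_E p (u n) \<and> dirichlet (u n) \<le> M \<and> powr_sum p (u n) \<le> M"
    using assms(1) by (auto simp: E_bounded_def)
  have "grad_sq w summable_on UNIV"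
  proof (rule infsum_limit_bounded[of "\<lambda>n. grad_sq (u n)" M])
    show "(\<lambda>n. grad_sq (u n) x) \<longlonglongrightarrow> grad_sq w x" for x
      by (rule grad_prod_tendsto) (rule lim)+
  qed (use M in \<open>auto simp: in_E_def dirichlet_def\<close>)
  moreover have "(\<lambda>x. \<bar>w x\<bar> powr p) summable_on UNIV"
  proof (rule infsum_limit_bounded[of "\<lambda>n x. \<bar>u n x\<bar> powr p" M])
    show "(\<lambda>n. \<bar>u n x\<bar> powr p) \<longlonglongrightarrow> \<bar>w x\<bar> powr p" for x
      using continuous_on_tendsto_compose[OF continuous_abs_powr[OF assms(2)] lim[of x]] by simp
  qed (use M in \<open>auto simp: in_E_def powr_sum_def\<close>)
  ultimately show ?thesis by (simp add: in_E_def)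
qed

text \<open>Testing along every bounded sequence expresses convergence of the derivatives in the
  dual norm, in a form that passes directly to subsequences and to translates with moving
  centres.\<close>

definition ps_seq ::
  "real \<Rightarrow> real \<Rightarrow> (int ^ 'n \<Rightarrow> real) \<Rightarrow> (int ^ 'n \<Rightarrow> real) \<Rightarrow> real \<Rightarrow> (nat \<Rightarrow> int ^ 'n \<Rightarrow> real) \<Rightarrow> bool"
  where
  "ps_seq p q a b c u \<longleftrightarrow> E_bounded p u \<and> (\<lambda>n. energy p q a b (u n)) \<longlonglongrightarrow> c \<and>
     (\<forall>\<phi>. E_bounded p \<phi> \<longrightarrow> (\<lambda>n. energy_deriv p q a b (u n) (\<phi> n)) \<longlonglongrightarrow> 0)"

lemma ps_seqD:
  assumes "ps_seq p q a b c u"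
  shows "E_bounded p u" "(\<lambda>n. energy p q a b (u n)) \<longlonglongrightarrow> c"
    "E_bounded p \<phi> \<Longrightarrow> (\<lambda>n. energy_deriv p q a b (u n) (\<phi> n)) \<longlonglongrightarrow> 0"
  using assms by (auto simp: ps_seq_def)

lemma ps_seq_subseq:
  assumes "ps_seq p q a b c u" "strict_mono r"
  shows "ps_seq p q a b c (\<lambda>n. u (r n))"
  unfolding ps_seq_def
proof (intro conjI allI impI)
  show "E_bounded p (\<lambda>n. u (r n))" by (rule E_bounded_compose[OF ps_seqD(1)[OF assms(1)]])
  show "(\<lambda>n. energy p q a b (u (r n))) \<longlonglongrightarrow> c"
    using LIMSEQ_subseq_LIMSEQ[OF ps_seqD(2)[OF assms(1)] assms(2)] by (simp add: o_def)
next
  fix \<phi> :: "nat \<Rightarrow> int ^ 'a \<Rightarrow> real" assume \<phi>: "E_bounded p \<phi>"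
  have inj: "inj r" using assms(2) by (rule strict_mono_imp_inj_on)
  \<comment> \<open>A test sequence for the subsequence is extended to all indices: off the range of
    r, \<open>inv r\<close> still selects some member of \<phi>, so the bound persists.\<close>
  have "(\<lambda>n. energy_deriv p q a b (u n) (\<phi> (inv r n))) \<longlonglongrightarrow> 0"
    by (rule ps_seqD(3)[OF assms(1) E_bounded_compose[OF \<phi>]])
  from LIMSEQ_subseq_LIMSEQ[OF this assms(2)]
  show "(\<lambda>n. energy_deriv p q a b (u (r n)) (\<phi> n)) \<longlonglongrightarrow> 0"
    using inj by (simp add: o_def)
qed

lemma energy_translate: "energy p q (\<lambda>_. a) (\<lambda>_. b) (\<lambda>x. u (x + z)) = energy p q (\<lambda>_. a) (\<lambda>_. b) u"
  unfolding energy_eq dirichlet_translate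
    infsum_translate[of "\<lambda>x. a * \<bar>u x\<bar> powr p" z] infsum_translate[of "\<lambda>x. b * \<bar>u x\<bar> powr q" z] ..

lemma energy_deriv_translate:
  "energy_deriv p q (\<lambda>_. a) (\<lambda>_. b) (\<lambda>x. u (x + z)) (\<lambda>x. \<phi> (x + z)) = energy_deriv p q (\<lambda>_. a) (\<lambda>_. b) u \<phi>"
  unfolding energy_deriv_eq grad_prod_translate infsum_translate[of "grad_prod u \<phi>" z]
    infsum_translate[of "\<lambda>x. a * (sgn_powr p (u x) * \<phi> x)" z]
    infsum_translate[of "\<lambda>x. b * (sgn_powr q (u x) * \<phi> x)" z] ..

text \<open>The translation is moved onto the test functions, whose bounds are translation
  invariant.\<close>

lemma ps_seq_translate:
  assumes "ps_seq p q (\<lambda>_. a) (\<lambda>_. b) c u"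
  shows "ps_seq p q (\<lambda>_. a) (\<lambda>_. b) c (\<lambda>n x. u n (x + y n))"
  unfolding ps_seq_def energy_translate
proof (intro conjI allI impI)
  show "E_bounded p (\<lambda>n x. u n (x + y n))" by (rule E_bounded_translate[OF ps_seqD(1)[OF assms]])
  show "(\<lambda>n. energy p q (\<lambda>_. a) (\<lambda>_. b) (u n)) \<longlonglongrightarrow> c" by (rule ps_seqD(2)[OF assms])
next
  fix \<phi> :: "nat \<Rightarrow> int ^ 'a \<Rightarrow> real" assume \<phi>: "E_bounded p \<phi>"
  have "(\<lambda>n. energy_deriv p q (\<lambda>_. a) (\<lambda>_. b) (u n) (\<lambda>x. \<phi> n (x + (- y n)))) \<longlonglongrightarrow> 0"
    by (rule ps_seqD(3)[OF assms E_bounded_translate[OF \<phi>]])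
  moreover have "energy_deriv p q (\<lambda>_. a) (\<lambda>_. b) (\<lambda>x. u n (x + y n)) (\<phi> n)
      = energy_deriv p q (\<lambda>_. a) (\<lambda>_. b) (u n) (\<lambda>x. \<phi> n (x + (- y n)))" for n
    using energy_deriv_translate[of p q a b "u n" "y n" "\<lambda>x. \<phi> n (x + (- y n))"] by simp
  ultimately show "(\<lambda>n. energy_deriv p q (\<lambda>_. a) (\<lambda>_. b) (\<lambda>x. u n (x + y n)) (\<phi> n)) \<longlonglongrightarrow> 0" by simp
qed

text \<open>Fixed test functions come first: along them the derivatives at u and at v tend to 0, so
  the splitting makes w critical. Then the derivative at w drops out of the splitting along moving
  test functions, which leaves the Palais-Smale property of v.\<close>

lemma ps_seq_split:
  assumes ps: "ps_seq p q a b c u" and pq: "2 \<le> p" "p < q"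
    and a: "vanishes (\<lambda>x. a x - abar)" and b: "vanishes (\<lambda>x. b x - bbar)"
    and lim: "\<And>x. (\<lambda>n. u n x) \<longlonglongrightarrow> w x"
  shows "in_E p w"
    and "\<And>\<phi>. in_E p \<phi> \<Longrightarrow> energy_deriv p q a b w \<phi> = 0"
    and "ps_seq p q (\<lambda>_. abar) (\<lambda>_. bbar) (c - energy p q a b w) (\<lambda>n x. u n x - w x)"
proof -
  have p: "p > 0" "p > 1" "p \<le> q" "q > 1" using pq by auto
  note uE = ps_seqD(1)[OF ps]
  show wE: "in_E p w" by (rule E_bounded_limit_in_E[OF uE p(1) lim])
  define v where "v n x = u n x - w x" for n x
  have uv: "u n = (\<lambda>x. v n x + w x)" for n by (simp add: v_def)
  have vE: "E_bounded p v"
    unfolding v_def using E_bounded_diff[OF uE E_bounded_const[OF wE]] p by simp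
  have v0: "(\<lambda>n. v n x) \<longlonglongrightarrow> 0" for x
    unfolding v_def using tendsto_diff[OF lim[of x] tendsto_const[of "w x"]] by simp
  have vin: "in_E p (v n)" for n using E_bounded_in_E[OF vE] .
  obtain M where M: "\<And>n. dirichlet (v n) \<le> M" using vE by (auto simp: E_bounded_def)
  have vs: "(\<lambda>x. \<bar>v n x\<bar> powr s) summable_on UNIV" if "s \<ge> p" for n s
    using in_E_powr'[OF vin p(1) that] .
  have ws: "(\<lambda>x. \<bar>w x\<bar> powr s) summable_on UNIV" if "s \<ge> p" for s
    using in_E_powr'[OF wE p(1) that] .

  have en_s: "(\<lambda>n. (\<Sum>\<^sub>\<infinity>x. a x * \<bar>v n x + w x\<bar> powr s) - (\<Sum>\<^sub>\<infinity>x. abar * \<bar>v n x\<bar> powr s)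
              - (\<Sum>\<^sub>\<infinity>x. a x * \<bar>w x\<bar> powr s)) \<longlonglongrightarrow> 0"
    if s: "s \<ge> p" and a: "vanishes (\<lambda>x. a x - abar)" for s abar and a :: "int ^ 'a \<Rightarrow> real"
  proof -
    obtain M where "\<And>n. powr_sum s (v n) \<le> M" using E_bounded_powr_sum[OF vE p(1) s] by blast
    then show ?thesis using s p by (intro powr_splitting a v0 vs ws) auto
  qed
  have grad0: "(\<lambda>n. \<Sum>\<^sub>\<infinity>x. grad_prod (v n) \<phi> x) \<longlonglongrightarrow> 0" if "in_E p \<phi>" for \<phi>
    by (rule grad_prod_tendsto_0[OF v0 in_E_grad[OF vin] M in_E_grad[OF that]])
  \<comment> \<open>The quadratic part splits exactly up to a cross term, which \<open>grad0\<close>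
    sends to 0.\<close>
  have dir: "dirichlet (u n) = dirichlet (v n) + dirichlet w + 2 * (\<Sum>\<^sub>\<infinity>x. grad_prod (v n) w x)" for n
  proof -
    have 2: "(\<lambda>x. 2 * grad_prod (v n) w x) summable_on UNIV"
      by (intro summable_on_cmult_right grad_prod_summable[OF vin wE])
    have "(\<Sum>\<^sub>\<infinity>x. grad_sq (v n) x + grad_sq w x + 2 * grad_prod (v n) w x)
        = (\<Sum>\<^sub>\<infinity>x. grad_sq (v n) x + grad_sq w x) + (\<Sum>\<^sub>\<infinity>x. 2 * grad_prod (v n) w x)"
      by (rule infsum_add[OF summable_on_add[OF in_E_grad[OF vin] in_E_grad[OF wE]] 2])
    also have "(\<Sum>\<^sub>\<infinity>x. grad_sq (v n) x + grad_sq w x) = dirichlet (v n) + dirichlet w"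
      unfolding dirichlet_def by (rule infsum_add[OF in_E_grad[OF vin] in_E_grad[OF wE]])
    finally show ?thesis unfolding uv dirichlet_def grad_sq_add by (simp add: infsum_cmult_right')
  qed
  have "(\<lambda>n. (\<Sum>\<^sub>\<infinity>x. grad_prod (v n) w x)
      + (1 / p) * ((\<Sum>\<^sub>\<infinity>x. a x * \<bar>v n x + w x\<bar> powr p) - (\<Sum>\<^sub>\<infinity>x. abar * \<bar>v n x\<bar> powr p)
              - (\<Sum>\<^sub>\<infinity>x. a x * \<bar>w x\<bar> powr p))
      - (1 / q) * ((\<Sum>\<^sub>\<infinity>x. b x * \<bar>v n x + w x\<bar> powr q) - (\<Sum>\<^sub>\<infinity>x. bbar * \<bar>v n x\<bar> powr q)
              - (\<Sum>\<^sub>\<infinity>x. b x * \<bar>w x\<bar> powr q))) \<longlonglongrightarrow> 0 + (1 / p) * 0 - (1 / q) * 0"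
    using p by (intro tendsto_add tendsto_diff tendsto_mult_left grad0 wE en_s a b) auto
  then have "(\<lambda>n. energy p q a b (u n) - energy p q (\<lambda>_. abar) (\<lambda>_. bbar) (v n) - energy p q a b w) \<longlonglongrightarrow> 0"
    unfolding energy_eq dir by (simp add: v_def algebra_simps)
  from tendsto_diff[OF tendsto_diff[OF ps_seqD(2)[OF ps] tendsto_const[of "energy p q a b w"]] this]
  have en: "(\<lambda>n. energy p q (\<lambda>_. abar) (\<lambda>_. bbar) (v n)) \<longlonglongrightarrow> c - energy p q a b w"
    by (simp add: algebra_simps)

  have de_s: "(\<lambda>n. (\<Sum>\<^sub>\<infinity>x. a x * (sgn_powr s (v n x + w x) * \<phi> n x)) - (\<Sum>\<^sub>\<infinity>x. abar * (sgn_powr s (v n x) * \<phi> n x))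
              - (\<Sum>\<^sub>\<infinity>x. a x * (sgn_powr s (w x) * \<phi> n x))) \<longlonglongrightarrow> 0"
    if s: "s \<ge> p" and a: "vanishes (\<lambda>x. a x - abar)" and \<phi>: "E_bounded p \<phi>"
    for s abar \<phi> and a :: "int ^ 'a \<Rightarrow> real"
  proof -
    obtain M1 where "\<And>n. powr_sum s (v n) \<le> M1" using E_bounded_powr_sum[OF vE p(1) s] by blast
    moreover obtain M2 where "\<And>n. powr_sum s (\<phi> n) \<le> M2" using E_bounded_powr_sum[OF \<phi> p(1) s] by blast
    ultimately have M: "powr_sum s (v n) \<le> max M1 M2" "powr_sum s (\<phi> n) \<le> max M1 M2" for n
      by (auto simp: le_max_iff_disj)
    have \<phi>s: "(\<lambda>x. \<bar>\<phi> n x\<bar> powr s) summable_on UNIV" for n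
      using in_E_powr'[OF E_bounded_in_E[OF \<phi>] p(1) s] .
    show ?thesis using sgn_powr_splitting[OF _ a v0 vs[OF s] M(1) \<phi>s M(2) ws[OF s]] s p by simp
  qed
  have de: "(\<lambda>n. energy_deriv p q a b (u n) (\<phi> n) - energy_deriv p q (\<lambda>_. abar) (\<lambda>_. bbar) (v n) (\<phi> n)
      - energy_deriv p q a b w (\<phi> n)) \<longlonglongrightarrow> 0" if \<phi>: "E_bounded p \<phi>" for \<phi>
  proof -
    have gr: "(\<Sum>\<^sub>\<infinity>x. grad_prod (u n) (\<phi> n) x) = (\<Sum>\<^sub>\<infinity>x. grad_prod (v n) (\<phi> n) x) + (\<Sum>\<^sub>\<infinity>x. grad_prod w (\<phi> n) x)" for n
      unfolding uv grad_prod_add_left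
      by (rule infsum_add[OF grad_prod_summable[OF vin E_bounded_in_E[OF \<phi>]]
            grad_prod_summable[OF wE E_bounded_in_E[OF \<phi>]]])
    have "(\<lambda>n. ((\<Sum>\<^sub>\<infinity>x. a x * (sgn_powr p (v n x + w x) * \<phi> n x)) - (\<Sum>\<^sub>\<infinity>x. abar * (sgn_powr p (v n x) * \<phi> n x))
              - (\<Sum>\<^sub>\<infinity>x. a x * (sgn_powr p (w x) * \<phi> n x)))
       - ((\<Sum>\<^sub>\<infinity>x. b x * (sgn_powr q (v n x + w x) * \<phi> n x)) - (\<Sum>\<^sub>\<infinity>x. bbar * (sgn_powr q (v n x) * \<phi> n x))
              - (\<Sum>\<^sub>\<infinity>x. b x * (sgn_powr q (w x) * \<phi> n x)))) \<longlonglongrightarrow> 0 - 0"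
      using p by (intro tendsto_diff de_s a b \<phi>) auto
    then show ?thesis unfolding energy_deriv_eq gr by (simp add: v_def algebra_simps)
  qed
  \<comment> \<open>For a fixed \<phi> this follows from weak convergence of v to 0 alone; the
    Palais-Smale property of v is not yet available.\<close>
  have vd: "(\<lambda>n. energy_deriv p q (\<lambda>_. abar) (\<lambda>_. bbar) (v n) \<phi>) \<longlonglongrightarrow> 0" if \<phi>: "in_E p \<phi>" for \<phi>
  proof -
    have s0: "(\<lambda>n. \<Sum>\<^sub>\<infinity>x. sgn_powr s (v n x) * \<phi> x) \<longlonglongrightarrow> 0" if s: "s \<ge> p" for s
    proof -
      obtain M where "\<And>n. powr_sum s (v n) \<le> M" using E_bounded_powr_sum[OF vE p(1) s] by blast
      then show ?thesis using s p by (intro sgn_powr_mult_tendsto_0 v0 vs in_E_powr'[OF \<phi>]) auto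
    qed
    have "(\<lambda>n. (\<Sum>\<^sub>\<infinity>x. grad_prod (v n) \<phi> x) + abar * (\<Sum>\<^sub>\<infinity>x. sgn_powr p (v n x) * \<phi> x)
        - bbar * (\<Sum>\<^sub>\<infinity>x. sgn_powr q (v n x) * \<phi> x)) \<longlonglongrightarrow> 0 + abar * 0 - bbar * 0"
      using p by (intro tendsto_add tendsto_diff tendsto_mult_left grad0 \<phi> s0) auto
    then show ?thesis unfolding energy_deriv_eq infsum_cmult_right' by simp
  qed
  show w_crit: "energy_deriv p q a b w \<phi> = 0" if \<phi>: "in_E p \<phi>" for \<phi>
  proof -
    have "(\<lambda>n. energy_deriv p q a b w \<phi>) \<longlonglongrightarrow> 0 - 0 - 0"
      using tendsto_diff[OF tendsto_diff[OF ps_seqD(3)[OF ps E_bounded_const[OF \<phi>]] vd[OF \<phi>]]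
          de[OF E_bounded_const[OF \<phi>]]] by simp
    then show ?thesis by (simp add: LIMSEQ_const_iff)
  qed
  have "(\<lambda>n. energy_deriv p q (\<lambda>_. abar) (\<lambda>_. bbar) (v n) (\<phi> n)) \<longlonglongrightarrow> 0" if \<phi>: "E_bounded p \<phi>" for \<phi>
    using tendsto_diff[OF ps_seqD(3)[OF ps \<phi>] de[OF \<phi>]] w_crit[OF E_bounded_in_E[OF \<phi>]] by simp
  with vE en have "ps_seq p q (\<lambda>_. abar) (\<lambda>_. bbar) (c - energy p q a b w) v"
    by (simp add: ps_seq_def)
  moreover have "v = (\<lambda>n x. u n x - w x)" by (simp add: fun_eq_iff v_def)
  ultimately show "ps_seq p q (\<lambda>_. abar) (\<lambda>_. bbar) (c - energy p q a b w) (\<lambda>n x. u n x - w x)"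
    by simp
qed

subsection \<open>Extraction of bubbles\<close>

text \<open>Subtracting 1/q times the derivative tested with u itself cancels the q-sum and leaves
  nonnegative multiples of the Dirichlet and l^p sums.\<close>

lemma ps_seq_level_nonneg:
  assumes ps: "ps_seq p q (\<lambda>_. abar) (\<lambda>_. bbar) c v" and pq: "2 \<le> p" "p < q" and abar: "abar > 0"
  shows "c \<ge> 0"
proof -
  have "(\<lambda>n. energy p q (\<lambda>_. abar) (\<lambda>_. bbar) (v n)
      - (1 / q) * energy_deriv p q (\<lambda>_. abar) (\<lambda>_. bbar) (v n) (v n)) \<longlonglongrightarrow> c - (1 / q) * 0"
    by (intro tendsto_diff tendsto_mult_left ps_seqD[OF ps])
  moreover have "energy p q (\<lambda>_. abar) (\<lambda>_. bbar) u - (1 / q) * energy_deriv p q (\<lambda>_. abar) (\<lambda>_. bbar) u u \<ge> 0" for u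
  proof -
    have "energy p q (\<lambda>_. abar) (\<lambda>_. bbar) u - (1 / q) * energy_deriv p q (\<lambda>_. abar) (\<lambda>_. bbar) u u
        = (1 / 2 - 1 / q) * dirichlet u + (1 / p - 1 / q) * (abar * powr_sum p u)"
      unfolding energy_eq energy_deriv_self infsum_cmult_right' powr_sum_def by (simp add: algebra_simps)
    also have "\<dots> \<ge> 0" using pq abar
      by (intro add_nonneg_nonneg mult_nonneg_nonneg) (auto simp: frac_le)
    finally show ?thesis .
  qed
  ultimately have "c - (1 / q) * 0 \<ge> 0" by (rule LIMSEQ_le_const[OF _ exI, OF _ allI, OF _ impI])
  then show ?thesis by simp
qed

text \<open>Uniform smallness sends the q-sum to 0 by interpolation. Testing the derivative with v
  itself then sends the sum of its two nonnegative remaining terms to 0, hence each of them.\<close>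

lemma ps_seq_vanishing:
  assumes ps: "ps_seq p q (\<lambda>_. abar) (\<lambda>_. bbar) c v" and pq: "2 \<le> p" "p < q" and abar: "abar > 0"
    and sup: "\<And>\<delta>. \<delta> > 0 \<Longrightarrow> eventually (\<lambda>n. \<forall>x. \<bar>v n x\<bar> \<le> \<delta>) sequentially"
  shows "c = 0" and "(\<lambda>n. E_norm p q (v n)) \<longlonglongrightarrow> 0"
proof -
  have p: "p > 0" "p \<le> q" using pq by auto
  obtain M where M: "\<And>n. in_E p (v n)" "\<And>n. powr_sum p (v n) \<le> M"
    using ps_seqD(1)[OF ps] by (auto simp: E_bounded_def)
  have "M \<ge> 0" using M(2)[of 0] powr_sum_nonneg[of p "v 0"] by linarith
  have q0: "(\<lambda>n. powr_sum q (v n)) \<longlonglongrightarrow> 0"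
  proof (rule tendstoI)
    fix e :: real assume e: "e > 0"
    \<comment> \<open>Chosen so that \<delta>^(q-p) (M + 1) = e; this is where p < q enters.\<close>
    define \<delta> where "\<delta> = (e / (M + 1)) powr (1 / (q - p))"
    have "\<delta> > 0" using e \<open>M \<ge> 0\<close> by (simp add: \<delta>_def)
    have "\<delta> powr (q - p) = e / (M + 1)" using e \<open>M \<ge> 0\<close> pq by (simp add: \<delta>_def powr_powr)
    then have \<delta>: "\<delta> powr (q - p) * M < e" using e \<open>M \<ge> 0\<close> by (simp add: divide_less_eq)
    show "eventually (\<lambda>n. dist (powr_sum q (v n)) 0 < e) sequentially"
      using sup[OF \<open>\<delta> > 0\<close>]
    proof (rule eventually_mono)
      fix n assume "\<forall>x. \<bar>v n x\<bar> \<le> \<delta>"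
      then have "powr_sum q (v n) \<le> \<delta> powr (q - p) * powr_sum p (v n)"
        using p by (intro powr_sum_le in_E_powr M) auto
      also have "\<dots> \<le> \<delta> powr (q - p) * M" using M(2) by (intro mult_left_mono) auto
      finally show "dist (powr_sum q (v n)) 0 < e" using \<delta> by (simp add: dist_real_def)
    qed
  qed
  have "(\<lambda>n. energy_deriv p q (\<lambda>_. abar) (\<lambda>_. bbar) (v n) (v n) + bbar * powr_sum q (v n)) \<longlonglongrightarrow> 0 + bbar * 0"
    by (intro tendsto_add tendsto_mult_left q0 ps_seqD[OF ps])
  then have s0: "(\<lambda>n. dirichlet (v n) + abar * powr_sum p (v n)) \<longlonglongrightarrow> 0"
    unfolding energy_deriv_self infsum_cmult_right' powr_sum_def by simp
  have d0: "(\<lambda>n. dirichlet (v n)) \<longlonglongrightarrow> 0"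
    by (rule tendsto_sandwich[OF _ _ tendsto_const s0]) (use abar in auto)
  have "(\<lambda>n. (1 / abar) * ((dirichlet (v n) + abar * powr_sum p (v n)) - dirichlet (v n)))
      \<longlonglongrightarrow> (1 / abar) * (0 - 0)"
    by (intro tendsto_mult_left tendsto_diff s0 d0)
  then have p0: "(\<lambda>n. powr_sum p (v n)) \<longlonglongrightarrow> 0" using abar by simp
  show "(\<lambda>n. E_norm p q (v n)) \<longlonglongrightarrow> 0" by (rule E_norm_tendsto_0[OF p M(1) d0 p0])
  have "(\<lambda>n. (1 / 2) * dirichlet (v n) + (1 / p) * (abar * powr_sum p (v n)) - (1 / q) * (bbar * powr_sum q (v n)))
      \<longlonglongrightarrow> (1 / 2) * 0 + (1 / p) * (abar * 0) - (1 / q) * (bbar * 0)"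
    by (intro tendsto_add tendsto_diff tendsto_mult_left d0 p0 q0)
  then have "(\<lambda>n. energy p q (\<lambda>_. abar) (\<lambda>_. bbar) (v n)) \<longlonglongrightarrow> 0"
    unfolding energy_eq infsum_cmult_right' powr_sum_def by simp
  then show "c = 0" using ps_seqD(2)[OF ps] LIMSEQ_unique by blast
qed

definition critical :: "real \<Rightarrow> real \<Rightarrow> real \<Rightarrow> real \<Rightarrow> (int ^ 'n \<Rightarrow> real) \<Rightarrow> bool" where
  "critical p q abar bbar U \<longleftrightarrow> in_E p U \<and> nontrivial U \<and>
     (\<forall>\<phi>. in_E p \<phi> \<longrightarrow> energy_deriv p q (\<lambda>_. abar) (\<lambda>_. bbar) U \<phi> = 0)"

text \<open>Points where |v| > \<delta> are moved to the origin; the translates then have a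
  pointwise limit with |U 0| \<ge> \<delta>. Splitting takes place in the moved frame, and the
  remainder is moved back.\<close>

lemma ps_seq_bubble:
  assumes ps: "ps_seq p q (\<lambda>_. abar) (\<lambda>_. bbar) c v" and pq: "2 \<le> p" "p < q"
    and "\<delta> > 0" and not: "\<not> eventually (\<lambda>n. \<forall>x. \<bar>v n x\<bar> \<le> \<delta>) sequentially"
  obtains r y U where "strict_mono (r :: nat \<Rightarrow> nat)" "critical p q abar bbar U"
    "\<And>x. (\<lambda>n. v (r n) (x + y n)) \<longlonglongrightarrow> U x"
    "ps_seq p q (\<lambda>_. abar) (\<lambda>_. bbar) (c - energy p q (\<lambda>_. abar) (\<lambda>_. bbar) U) (\<lambda>n x. v (r n) x - U (x - y n))"
proof -
  have "p > 0" using pq by simp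
  obtain r1 :: "nat \<Rightarrow> nat" where r1: "strict_mono r1" "\<And>n. \<not> (\<forall>x. \<bar>v (r1 n) x\<bar> \<le> \<delta>)"
    using not_eventually_sequentiallyD[OF not] by blast
  then have "\<forall>n. \<exists>x. \<bar>v (r1 n) x\<bar> > \<delta>" by (meson not_le)
  then obtain y1 where y1: "\<And>n. \<bar>v (r1 n) (y1 n)\<bar> > \<delta>" by metis
  obtain M where M: "\<And>n x. \<bar>v n x\<bar> \<le> M" using E_bounded_abs_le[OF ps_seqD(1)[OF ps] \<open>p > 0\<close>] by blast
  obtain r2 U where r2: "strict_mono (r2 :: nat \<Rightarrow> nat)"
    and U: "\<And>x. (\<lambda>n. v (r1 (r2 n)) (x + y1 (r2 n))) \<longlonglongrightarrow> U x"
    using pointwise_convergent_subsequence[of "\<lambda>n x. v (r1 n) (x + y1 n)" M] M by blast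
  define r y where "r n = r1 (r2 n)" and "y n = y1 (r2 n)" for n
  have r: "strict_mono r"
    using strict_mono_o[OF r1(1) r2] by (simp add: r_def[abs_def] o_def)
  have U: "(\<lambda>n. v (r n) (x + y n)) \<longlonglongrightarrow> U x" for x using U by (simp add: r_def y_def)
  have ps': "ps_seq p q (\<lambda>_. abar) (\<lambda>_. bbar) c (\<lambda>n x. v (r n) (x + y n))"
    by (rule ps_seq_translate[OF ps_seq_subseq[OF ps r]])
  note split = ps_seq_split[OF ps' pq vanishes_const vanishes_const U]
  have "\<bar>U 0\<bar> \<ge> \<delta>"
  proof (rule LIMSEQ_le_const[OF tendsto_rabs[OF U]])
    show "\<exists>N. \<forall>n\<ge>N. \<delta> \<le> \<bar>v (r n) (0 + y n)\<bar>"
      using y1 by (auto simp: r_def y_def intro: less_imp_le)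
  qed
  then have "U 0 \<noteq> 0" using \<open>\<delta> > 0\<close> by auto
  then have crit: "critical p q abar bbar U"
    unfolding critical_def nontrivial_def using split(1,2) by blast
  have "ps_seq p q (\<lambda>_. abar) (\<lambda>_. bbar) (c - energy p q (\<lambda>_. abar) (\<lambda>_. bbar) U)
      (\<lambda>n x. v (r n) (x + - y n + y n) - U (x + - y n))"
    by (rule ps_seq_translate[OF split(3)])
  then have "ps_seq p q (\<lambda>_. abar) (\<lambda>_. bbar) (c - energy p q (\<lambda>_. abar) (\<lambda>_. bbar) U) (\<lambda>n x. v (r n) x - U (x - y n))"
    by simp
  with that[OF r crit U] show ?thesis .
qed

text \<open>The clause on \<open>z\<close> makes the induction go through: it says that later bubbles escape from
  every frame in which \<open>v\<close> already converges to 0, in particular from the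
  frames of the bubbles already removed.\<close>

definition bubble_tree ::
  "real \<Rightarrow> real \<Rightarrow> real \<Rightarrow> real \<Rightarrow> real \<Rightarrow> (nat \<Rightarrow> int ^ 'n \<Rightarrow> real) \<Rightarrow>
   nat \<Rightarrow> (nat \<Rightarrow> int ^ 'n \<Rightarrow> real) \<Rightarrow> (nat \<Rightarrow> nat \<Rightarrow> int ^ 'n) \<Rightarrow> (nat \<Rightarrow> nat) \<Rightarrow> bool"
  where
  "bubble_tree p q abar bbar c v k U y r \<longleftrightarrow> strict_mono r \<and>
     (\<forall>i\<in>{1..k}. critical p q abar bbar (U i)) \<and>
     (\<forall>i\<in>{1..k}. \<forall>j\<in>{1..k}. i \<noteq> j \<longrightarrow> drifts_apart (y i) (y j)) \<and>
     (\<forall>z. (\<forall>x. (\<lambda>n. v n (x + z n)) \<longlonglongrightarrow> 0) \<longrightarrow> (\<forall>i\<in>{1..k}. drifts_apart (y i) (\<lambda>n. z (r n)))) \<and>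
     (\<lambda>n. E_norm p q (\<lambda>x. v (r n) x - (\<Sum>i=1..k. U i (x - y i n)))) \<longlonglongrightarrow> 0 \<and>
     (\<Sum>i=1..k. energy p q (\<lambda>_. abar) (\<lambda>_. bbar) (U i)) = c"

text \<open>Here m counts how many gaps \<alpha> the level can still pay for. Each bubble costs at
  least one, and m = 0 would mean a negative level.\<close>

lemma bubble_decomposition:
  assumes pq: "2 \<le> p" "p < q" and abar: "abar > 0"
    and gap: "\<And>U :: int ^ 'n \<Rightarrow> real. critical p q abar bbar U \<Longrightarrow> \<alpha> \<le> energy p q (\<lambda>_. abar) (\<lambda>_. bbar) U"
    and "ps_seq p q (\<lambda>_. abar) (\<lambda>_. bbar) c (v :: nat \<Rightarrow> int ^ 'n \<Rightarrow> real)" "c < real m * \<alpha>"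
  shows "\<exists>k U y r. bubble_tree p q abar bbar c v k U y r"
  using assms(5,6)
proof (induction m arbitrary: c v)
  case 0
  then show ?case using ps_seq_level_nonneg[OF 0(1) pq abar] by simp
next
  case (Suc m)
  show ?case
  proof (cases "\<forall>\<delta>>0. eventually (\<lambda>n. \<forall>x. \<bar>v n x\<bar> \<le> \<delta>) sequentially")
    case True
    then have "c = 0" "(\<lambda>n. E_norm p q (v n)) \<longlonglongrightarrow> 0"
      using ps_seq_vanishing[OF Suc.prems(1) pq abar] by blast+
    then have "bubble_tree p q abar bbar c v 0 (\<lambda>_ _. 0) (\<lambda>_ _. 0) id"
      by (simp add: bubble_tree_def strict_mono_def)
    then show ?thesis by blast
  next
    case False
    then obtain \<delta> where "\<delta> > 0" "\<not> eventually (\<lambda>n. \<forall>x. \<bar>v n x\<bar> \<le> \<delta>) sequentially" by blast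
    then obtain r0 y0 U0 where r0: "strict_mono (r0 :: nat \<Rightarrow> nat)" and crit0: "critical p q abar bbar U0"
      and lim0: "\<And>x. (\<lambda>n. v (r0 n) (x + y0 n)) \<longlonglongrightarrow> U0 x"
      and ps0: "ps_seq p q (\<lambda>_. abar) (\<lambda>_. bbar) (c - energy p q (\<lambda>_. abar) (\<lambda>_. bbar) U0)
            (\<lambda>n x. v (r0 n) x - U0 (x - y0 n))"
      by (rule ps_seq_bubble[OF Suc.prems(1) pq]) (rule that)
    define v' where "v' n x = v (r0 n) x - U0 (x - y0 n)" for n x
    have ps': "ps_seq p q (\<lambda>_. abar) (\<lambda>_. bbar) (c - energy p q (\<lambda>_. abar) (\<lambda>_. bbar) U0) v'"
      using ps0 by (simp add: v'_def[abs_def])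
    have "c - energy p q (\<lambda>_. abar) (\<lambda>_. bbar) U0 < real m * \<alpha>"
      using Suc.prems(2) gap[OF crit0] by (simp add: algebra_simps)
    from Suc.IH[OF ps' this]
    obtain k U y r where tree:
      "bubble_tree p q abar bbar (c - energy p q (\<lambda>_. abar) (\<lambda>_. bbar) U0) v' k U y r" by blast
    have r: "strict_mono r"
      and crit: "\<And>i. i \<in> {1..k} \<Longrightarrow> critical p q abar bbar (U i)"
      and drift: "\<And>i j. i \<in> {1..k} \<Longrightarrow> j \<in> {1..k} \<Longrightarrow> i \<noteq> j \<Longrightarrow> drifts_apart (y i) (y j)"
      and esc: "\<And>z i. (\<And>x. (\<lambda>n. v' n (x + z n)) \<longlonglongrightarrow> 0) \<Longrightarrow> i \<in> {1..k} \<Longrightarrow> drifts_apart (y i) (\<lambda>n. z (r n))"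
      and rem: "(\<lambda>n. E_norm p q (\<lambda>x. v' (r n) x - (\<Sum>i=1..k. U i (x - y i n)))) \<longlonglongrightarrow> 0"
      and lev: "(\<Sum>i=1..k. energy p q (\<lambda>_. abar) (\<lambda>_. bbar) (U i)) = c - energy p q (\<lambda>_. abar) (\<lambda>_. bbar) U0"
      using tree unfolding bubble_tree_def by blast+
    \<comment> \<open>The bubble found first gets the last index, so those of the recursive call
      keep theirs; its centres are restricted to the later subsequence r.\<close>
    define U' where "U' = U(Suc k := U0)"
    define y' where "y' = y(Suc k := \<lambda>n. y0 (r n))"
    have sum': "(\<Sum>i=1..Suc k. f (U' i) (y' i)) = (\<Sum>i=1..k. f (U i) (y i)) + f U0 (\<lambda>n. y0 (r n))"
      for f :: "(int ^ 'n \<Rightarrow> real) \<Rightarrow> (nat \<Rightarrow> int ^ 'n) \<Rightarrow> real"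
    proof -
      have "(\<Sum>i=1..k. f (U' i) (y' i)) = (\<Sum>i=1..k. f (U i) (y i))"
        by (rule sum.cong) (auto simp: U'_def y'_def)
      then show ?thesis by (simp add: U'_def y'_def)
    qed
    \<comment> \<open>In the frame y0 the remainder v' tends to 0, so the clause on z applies with z
      = y0.\<close>
    have esc0: "drifts_apart (y i) (\<lambda>n. y0 (r n))" if "i \<in> {1..k}" for i
    proof (rule esc[OF _ that])
      show "(\<lambda>n. v' n (x + y0 n)) \<longlonglongrightarrow> 0" for x
        using tendsto_diff[OF lim0[of x] tendsto_const[of "U0 x"]] by (simp add: v'_def)
    qed
    \<comment> \<open>If the frames stayed at a constant distance d along a subsequence, the limit
      U0 in the frame y0 would be a shift of the limit 0 in the frame z.\<close>
    have escz: "drifts_apart y0 (\<lambda>n. z (r0 n))" if z: "\<And>x. (\<lambda>n. v n (x + z n)) \<longlonglongrightarrow> 0" for z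
    proof (rule ccontr)
      assume "\<not> drifts_apart y0 (\<lambda>n. z (r0 n))"
      then obtain d where "\<not> eventually (\<lambda>n. y0 n - z (r0 n) \<noteq> d) sequentially"
        by (auto simp: drifts_apart_def)
      from not_eventually_sequentiallyD[OF this]
      obtain s :: "nat \<Rightarrow> nat" where s: "strict_mono s" "\<And>n. y0 (s n) - z (r0 (s n)) = d" by blast
      have "U0 x = 0" for x
      proof -
        have "(\<lambda>n. v (r0 (s n)) (x + d + z (r0 (s n)))) \<longlonglongrightarrow> 0"
          using LIMSEQ_subseq_LIMSEQ[OF z strict_mono_o[OF r0 s(1)], of "x + d"] by (simp add: o_def)
        moreover have "x + d + z (r0 (s n)) = x + y0 (s n)" for n using s(2)[of n] by (simp add: algebra_simps)
        moreover have "(\<lambda>n. v (r0 (s n)) (x + y0 (s n))) \<longlonglongrightarrow> U0 x"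
          using LIMSEQ_subseq_LIMSEQ[OF lim0 s(1), of x] by (simp add: o_def)
        ultimately show ?thesis using LIMSEQ_unique by fastforce
      qed
      then show False using crit0 by (simp add: critical_def nontrivial_def)
    qed
    have escz': "drifts_apart (y' i) (\<lambda>n. z (r0 (r n)))"
      if z: "\<And>x. (\<lambda>n. v n (x + z n)) \<longlonglongrightarrow> 0" and i: "i \<in> {1..Suc k}" for z i
    proof (cases "i = Suc k")
      case True
      then show ?thesis
        using drifts_apart_compose[OF escz[OF z] filterlim_subseq[OF r]] by (simp add: y'_def)
    next
      case False
      \<comment> \<open>For the recursive clause v' must tend to 0 in the frame z: v does so by
        assumption, and the removed bubble does because its centre escapes from z.\<close>
      have "(\<lambda>n. v' n (x + z (r0 n))) \<longlonglongrightarrow> 0" for x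
      proof -
        have "(\<lambda>n. v (r0 n) (x + z (r0 n))) \<longlonglongrightarrow> 0"
          using LIMSEQ_subseq_LIMSEQ[OF z r0, of x] by (simp add: o_def)
        moreover have "(\<lambda>n. U0 (x + z (r0 n) - y0 n)) \<longlonglongrightarrow> 0"
        proof (rule drifts_apart_tendsto_0[OF escz[OF z]])
          have "vanishes U0" using crit0 pq by (intro in_E_vanishes) (auto simp: critical_def)
          then show "finite {x. \<bar>U0 x\<bar> \<ge> \<epsilon>}" if "\<epsilon> > 0" for \<epsilon> using that by (simp add: vanishes_def)
        qed
        ultimately show ?thesis using tendsto_diff by (fastforce simp: v'_def)
      qed
      from esc[OF this, of i] show ?thesis using i False by (simp add: y'_def)
    qed
    have "bubble_tree p q abar bbar c v (Suc k) U' y' (\<lambda>n. r0 (r n))"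
      unfolding bubble_tree_def
    proof (intro conjI)
      show "strict_mono (\<lambda>n. r0 (r n))" using strict_mono_o[OF r0 r] by (simp add: o_def)
      show "\<forall>i\<in>{1..Suc k}. critical p q abar bbar (U' i)"
        using crit crit0 by (simp add: U'_def)
      show "\<forall>i\<in>{1..Suc k}. \<forall>j\<in>{1..Suc k}. i \<noteq> j \<longrightarrow> drifts_apart (y' i) (y' j)"
      proof (intro ballI impI)
        fix i j assume "i \<in> {1..Suc k}" "j \<in> {1..Suc k}" "i \<noteq> j"
        then show "drifts_apart (y' i) (y' j)"
          using drift[of i j] esc0[of i] drifts_apart_sym[OF esc0[of j]]
          by (auto simp: y'_def le_Suc_eq)
      qed
      show "\<forall>z. (\<forall>x. (\<lambda>n. v n (x + z n)) \<longlonglongrightarrow> 0) \<longrightarrow>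
          (\<forall>i\<in>{1..Suc k}. drifts_apart (y' i) (\<lambda>n. z (r0 (r n))))"
        using escz' by blast
      have "v (r0 (r n)) x - (\<Sum>i=1..Suc k. U' i (x - y' i n)) = v' (r n) x - (\<Sum>i=1..k. U i (x - y i n))" for n x
        using sum'[of "\<lambda>U y. U (x - y n)"] by (simp add: v'_def)
      then show "(\<lambda>n. E_norm p q (\<lambda>x. v (r0 (r n)) x - (\<Sum>i=1..Suc k. U' i (x - y' i n)))) \<longlonglongrightarrow> 0"
        using rem by simp
      show "(\<Sum>i=1..Suc k. energy p q (\<lambda>_. abar) (\<lambda>_. bbar) (U' i)) = c"
        using sum'[of "\<lambda>U y. energy p q (\<lambda>_. abar) (\<lambda>_. bbar) U"] lev by simp
    qed
    then show ?thesis by blast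
  qed
qed

subsection \<open>Boundedness of Palais-Smale sequences\<close>

lemma vanishes_of_tendsto:
  assumes "(a \<longlongrightarrow> abar) (lattice_at_infinity :: (int ^ 'n) filter)"
  shows "vanishes (\<lambda>x. a x - abar)"
  unfolding vanishes_def
proof (intro allI impI)
  fix \<epsilon> :: real assume "\<epsilon> > 0"
  from finite_not_eventually_lattice_at_infinity[OF tendstoD[OF assms this]]
  show "finite {x. \<bar>a x - abar\<bar> \<ge> \<epsilon>}" by (simp add: dist_real_def not_less)
qed

lemma E_norm_le:
  assumes "E_bounded p \<phi>" "0 < p" "p \<le> q"
  obtains B where "B > 0" "\<And>n. E_norm p q (\<phi> n) \<le> B"
proof -
  obtain M where M: "\<And>n. dirichlet (\<phi> n) \<le> M" "\<And>n. powr_sum p (\<phi> n) \<le> M"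
    using assms(1) by (auto simp: E_bounded_def)
  obtain M' where M': "\<And>n. powr_sum q (\<phi> n) \<le> M'" using E_bounded_powr_sum[OF assms] by blast
  let ?B = "M powr (1 / 2) + M powr (1 / p) + M' powr (1 / q)"
  have "E_norm p q (\<phi> n) \<le> ?B" for n
    unfolding E_norm_eq using M M' assms by (intro add_mono powr_mono2) auto
  moreover have "?B \<ge> 0" by simp
  \<comment> \<open>The added 1 makes the bound positive, so that one may divide by it.\<close>
  ultimately have "E_norm p q (\<phi> n) \<le> ?B + 1" "?B + 1 > 0" for n by (smt (verit))+
  then show ?thesis using that by blast
qed

text \<open>Division by B puts the whole test sequence into the unit ball over which the dual norm
  is a supremum; linearity undoes the scaling.\<close>

lemma palais_smale_deriv_tendsto_0:
  assumes ps: "palais_smale p q a b c u" and p: "0 < p" "p \<le> q" and \<phi>: "E_bounded p \<phi>"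
  shows "(\<lambda>n. energy_deriv p q a b (u n) (\<phi> n)) \<longlonglongrightarrow> 0"
proof -
  obtain B where B: "B > 0" "\<And>n. E_norm p q (\<phi> n) \<le> B" using E_norm_le[OF \<phi> p] by blast
  let ?\<psi> = "\<lambda>n x. (1 / B) * \<phi> n x"
  have "?\<psi> n \<in> {\<phi> \<in> E_space p q. E_norm p q \<phi> \<le> 1}" for n
  proof -
    have "E_norm p q (?\<psi> n) = \<bar>1 / B\<bar> * E_norm p q (\<phi> n)" using p by (intro E_norm_cmult) auto
    also have "\<dots> \<le> 1" using B by simp
    finally show ?thesis using in_E_cmult[OF E_bounded_in_E[OF \<phi>], of "1 / B" n] by (simp add: E_space_eq[OF p])
  qed
  then have "ennreal \<bar>energy_deriv p q a b (u n) (?\<psi> n)\<bar> \<le> E_dual_norm p q (energy_deriv p q a b (u n))" for n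
    unfolding E_dual_norm_def by (rule SUP_upper)
  moreover have "(\<lambda>n. E_dual_norm p q (energy_deriv p q a b (u n))) \<longlonglongrightarrow> 0"
    using ps by (simp add: palais_smale_def)
  ultimately have "(\<lambda>n. ennreal \<bar>energy_deriv p q a b (u n) (?\<psi> n)\<bar>) \<longlonglongrightarrow> ennreal 0"
    unfolding ennreal_0 by (rule tendsto_sandwich[OF always_eventually always_eventually tendsto_const, OF allI allI, OF zero_le])
  then have "(\<lambda>n. \<bar>energy_deriv p q a b (u n) (?\<psi> n)\<bar>) \<longlonglongrightarrow> 0"
    by (rule tendsto_ennrealD) auto
  then have "(\<lambda>n. energy_deriv p q a b (u n) (?\<psi> n)) \<longlonglongrightarrow> 0" by (rule tendsto_rabs_zero_cancel)
  from tendsto_mult_left[OF this, of B]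
  have "(\<lambda>n. B * ((1 / B) * energy_deriv p q a b (u n) (\<phi> n))) \<longlonglongrightarrow> B * 0"
    by (simp only: energy_deriv_cmult)
  then show ?thesis using B(1) by simp
qed

lemma infinite_lattice: "infinite (UNIV :: (int ^ 'n) set)"
proof
  assume "finite (UNIV :: (int ^ 'n) set)"
  then have "finite (range (vec :: int \<Rightarrow> int ^ 'n))" by (rule rev_finite_subset) simp
  moreover have "inj (vec :: int \<Rightarrow> int ^ 'n)" by (auto simp: inj_def vec_eq_iff)
  ultimately show False using finite_imageD infinite_UNIV_int by blast
qed

text \<open>Since \<open>a\<close> may vanish at finitely many points, the weighted sum alone does not control
  \<open>\<bar>u x\<bar>\<close>; at such points the gradient propagates the bound along a path
  from a point where \<open>a\<close> is large.\<close>

lemma abs_le_coercive: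
  fixes a :: "int ^ 'n \<Rightarrow> real"
  assumes p: "2 \<le> p" and a0: "\<And>x. a x \<ge> 0" and av: "vanishes (\<lambda>x. a x - abar)" and abar: "abar > 0"
  shows "\<exists>C. \<forall>u. in_E p u \<longrightarrow> \<bar>u x\<bar> \<le> C * sqrt (1 + dirichlet u + (\<Sum>\<^sub>\<infinity>x. a x * \<bar>u x\<bar> powr p))"
    (is "?Q x")
proof -
  obtain K where K: "\<And>x. \<bar>a x\<bar> \<le> K" using vanishes_diff_bounded[OF av] by blast
  let ?T = "\<lambda>u. 1 + dirichlet u + (\<Sum>\<^sub>\<infinity>x. a x * \<bar>u x\<bar> powr p)"
  have A0: "(\<Sum>\<^sub>\<infinity>x. a x * \<bar>u x\<bar> powr p) \<ge> 0" for u
    by (rule infsum_nonneg) (simp add: a0)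
  have base: "?Q x" if x: "a x \<ge> abar / 2" for x
  proof (intro exI allI impI)
    fix u :: "int ^ 'n \<Rightarrow> real" assume u: "in_E p u"
    have T1: "?T u \<ge> 1" using A0[of u] dirichlet_nonneg[of u] by linarith
    have s: "(\<lambda>x. a x * \<bar>u x\<bar> powr p) summable_on UNIV"
      by (rule summable_bounded_mult[OF K in_E_powr[OF u]])
    have "abar / 2 * \<bar>u x\<bar> powr p \<le> a x * \<bar>u x\<bar> powr p" by (rule mult_right_mono[OF x]) simp
    also have "\<dots> \<le> (\<Sum>\<^sub>\<infinity>x. a x * \<bar>u x\<bar> powr p)"
      by (rule le_infsum_real[OF s]) (simp add: a0)
    also have "\<dots> \<le> ?T u" using dirichlet_nonneg[of u] by simp
    finally have "\<bar>u x\<bar> powr p \<le> (2 / abar) * ?T u" using abar by (simp add: field_simps)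
    then have "(\<bar>u x\<bar> powr p) powr (1 / p) \<le> ((2 / abar) * ?T u) powr (1 / p)"
      using p by (intro powr_mono2) auto
    moreover have "((2 / abar) * ?T u) powr (1 / p) = (2 / abar) powr (1 / p) * ?T u powr (1 / p)"
      by (subst powr_mult) (use T1 abar in auto)
    moreover have "(\<bar>u x\<bar> powr p) powr (1 / p) = \<bar>u x\<bar>" using p by (simp add: powr_powr)
    ultimately have "\<bar>u x\<bar> \<le> (2 / abar) powr (1 / p) * ?T u powr (1 / p)" by (simp only:)
    \<comment> \<open>The exponent is raised from 1/p to 1/2, the one that the gradient step
      produces; the summand 1 in T makes T \<ge> 1 and so permits this.\<close>
    also have "\<dots> \<le> (2 / abar) powr (1 / p) * ?T u powr (1 / 2)"
      using p T1 by (intro mult_left_mono powr_mono) (auto simp: frac_le)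
    finally show "\<bar>u x\<bar> \<le> (2 / abar) powr (1 / p) * sqrt (?T u)"
      using T1 by (simp add: powr_half_sqrt)
  qed
  have step: "?Q x" if "?Q z" "lattice_adj x z" for x z
  proof -
    from \<open>?Q z\<close> obtain C where "\<forall>u. in_E p u \<longrightarrow> \<bar>u z\<bar> \<le> C * sqrt (?T u)" by (rule exE)
    then have C: "\<bar>u z\<bar> \<le> C * sqrt (?T u)" if "in_E p u" for u using that by simp
    have "\<bar>u x\<bar> \<le> (C + 2) * sqrt (?T u)" if u: "in_E p u" for u
    proof -
      have "(u z - u x)\<^sup>2 \<le> 2 * grad_sq u x"
        using abs_diff_le_grad_sq[of "z - x" u x] \<open>lattice_adj x z\<close> by (simp add: lattice_adj_iff_dirs)
      moreover have "2 * grad_sq u x \<le> 2 * dirichlet u"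
        using le_infsum_real[OF in_E_grad[OF u], of x] by (simp add: dirichlet_def)
      moreover have "2 * d \<le> 4 * (1 + d + s)" if "d \<ge> 0" "s \<ge> 0" for d s :: real using that by simp
      from this[OF dirichlet_nonneg A0] have "2 * dirichlet u \<le> 4 * ?T u" .
      ultimately have "(u z - u x)\<^sup>2 \<le> 4 * ?T u" by (meson order_trans)
      then have "sqrt ((u z - u x)\<^sup>2) \<le> sqrt (4 * ?T u)" by (rule real_sqrt_le_mono)
      then have "\<bar>u z - u x\<bar> \<le> 2 * sqrt (?T u)" by (simp only: real_sqrt_abs real_sqrt_mult real_sqrt_four)
      then show ?thesis using C[OF u] by (simp add: distrib_right)
    qed
    then show ?thesis by blast
  qed
  have path: "(lattice_adj ^^ m) x z \<Longrightarrow> ?Q z \<Longrightarrow> ?Q x" for m x z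
  proof (induction m arbitrary: x)
    case 0
    then show ?case by simp
  next
    case (Suc m)
    then obtain x' where "lattice_adj x x'" "(lattice_adj ^^ m) x' z" by (meson relpowp_Suc_E2)
    then show ?case using Suc.IH Suc.prems(2) step by blast
  qed
  have "finite {x. \<bar>a x - abar\<bar> \<ge> abar / 2}"
    by (rule av[unfolded vanishes_def, rule_format]) (use abar in simp)
  then obtain z where "\<not> \<bar>a z - abar\<bar> \<ge> abar / 2" using ex_new_if_finite[OF infinite_lattice] by blast
  then have "a z \<ge> abar / 2" by (simp add: abs_if split: if_splits)
  moreover obtain m where "(lattice_adj ^^ m) x z" using lattice_connected by blast
  ultimately show ?thesis using path base by blast
qed

text \<open>Where a \<ge> abar/2 the weighted sum controls |u|^p. The finitely many other points use
  |u x| \<le> C x sqrt T, whose p-th power produces the exponent p/2, exactly what division of u by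
  sqrt T compensates.\<close>

lemma powr_sum_le_coercive:
  fixes a :: "int ^ 'n \<Rightarrow> real"
  assumes p: "2 \<le> p" and a0: "\<And>x. a x \<ge> 0" and av: "vanishes (\<lambda>x. a x - abar)" and abar: "abar > 0"
  shows "\<exists>C\<ge>0. \<forall>u. in_E p u \<longrightarrow>
    powr_sum p u \<le> C * (1 + dirichlet u + (\<Sum>\<^sub>\<infinity>x. a x * \<bar>u x\<bar> powr p)) powr (p / 2)"
proof -
  obtain K where K: "\<And>x. \<bar>a x\<bar> \<le> K" using vanishes_diff_bounded[OF av] by blast
  let ?T = "\<lambda>u. 1 + dirichlet u + (\<Sum>\<^sub>\<infinity>x. a x * \<bar>u x\<bar> powr p)"
  let ?F = "{x. \<bar>a x - abar\<bar> \<ge> abar / 2}"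
  have F: "finite ?F"
    by (rule av[unfolded vanishes_def, rule_format]) (use abar in simp)
  have "\<forall>x. \<exists>C. \<forall>u. in_E p u \<longrightarrow> \<bar>u x\<bar> \<le> C * sqrt (?T u)"
    by (intro allI) (rule abs_le_coercive[OF p a0 av abar])
  from choice[OF this] obtain C where C: "\<And>x u. in_E p u \<Longrightarrow> \<bar>u x\<bar> \<le> C x * sqrt (?T u)"
    by blast
  let ?C = "2 / abar + (\<Sum>x\<in>?F. \<bar>C x\<bar> powr p)"
  have "powr_sum p u \<le> ?C * ?T u powr (p / 2)" if u: "in_E p u" for u
  proof -
    have A0: "(\<Sum>\<^sub>\<infinity>x. a x * \<bar>u x\<bar> powr p) \<ge> 0" by (rule infsum_nonneg) (simp add: a0)
    have T1: "?T u \<ge> 1" using A0 dirichlet_nonneg[of u] by linarith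
    let ?g = "\<lambda>x. (2 / abar) * (a x * \<bar>u x\<bar> powr p)"
    let ?h = "\<lambda>x. if x \<in> ?F then \<bar>u x\<bar> powr p else 0"
    have sg: "?g summable_on UNIV"
      by (intro summable_on_cmult_right summable_bounded_mult[OF K in_E_powr[OF u]])
    have "?h summable_on UNIV \<longleftrightarrow> ?h summable_on ?F" by (rule summable_on_cong_neutral) auto
    then have sh: "?h summable_on UNIV" using F by simp
    have "infsum ?h UNIV = infsum ?h ?F" by (rule infsum_cong_neutral) auto
    then have ih: "infsum ?h UNIV = (\<Sum>x\<in>?F. \<bar>u x\<bar> powr p)" using F by simp
    have gh: "\<bar>u x\<bar> powr p \<le> ?g x + ?h x" for x
    proof (cases "x \<in> ?F")
      case True
      then show ?thesis using a0[of x] abar by simp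
    next
      case False
      then have "2 * a x \<ge> abar" by (simp add: abs_if split: if_splits)
      then have "abar * \<bar>u x\<bar> powr p \<le> 2 * a x * \<bar>u x\<bar> powr p" by (rule mult_right_mono) simp
      then show ?thesis using False abar by (simp add: field_simps)
    qed
    have "powr_sum p u \<le> (\<Sum>\<^sub>\<infinity>x. ?g x + ?h x)"
      unfolding powr_sum_def by (rule infsum_mono[OF in_E_powr[OF u] summable_on_add[OF sg sh]]) (rule gh)
    also have "\<dots> = (2 / abar) * (\<Sum>\<^sub>\<infinity>x. a x * \<bar>u x\<bar> powr p) + (\<Sum>x\<in>?F. \<bar>u x\<bar> powr p)"
      unfolding infsum_add[OF sg sh] ih infsum_cmult_right' ..
    also have "\<dots> \<le> (2 / abar) * ?T u powr (p / 2) + (\<Sum>x\<in>?F. \<bar>C x\<bar> powr p * ?T u powr (p / 2))"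
    proof (intro add_mono sum_mono mult_left_mono)
      have "(\<Sum>\<^sub>\<infinity>x. a x * \<bar>u x\<bar> powr p) \<le> ?T u powr 1" using T1 dirichlet_nonneg[of u] by simp
      also have "\<dots> \<le> ?T u powr (p / 2)" using T1 p by (intro powr_mono) auto
      finally show "(\<Sum>\<^sub>\<infinity>x. a x * \<bar>u x\<bar> powr p) \<le> ?T u powr (p / 2)" .
      show "0 \<le> 2 / abar" using abar by simp
      fix x
      have "\<bar>u x\<bar> \<le> C x * sqrt (?T u)" by (rule C[OF u])
      also have "\<dots> \<le> \<bar>C x\<bar> * ?T u powr (1 / 2)"
        using T1 by (simp add: powr_half_sqrt mult_right_mono)
      finally have "\<bar>u x\<bar> powr p \<le> (\<bar>C x\<bar> * ?T u powr (1 / 2)) powr p"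
        using p by (intro powr_mono2) auto
      also have "\<dots> = \<bar>C x\<bar> powr p * ?T u powr (p / 2)"
        using T1 by (simp add: powr_mult powr_powr)
      finally show "\<bar>u x\<bar> powr p \<le> \<bar>C x\<bar> powr p * ?T u powr (p / 2)" .
    qed
    also have "\<dots> = ?C * ?T u powr (p / 2)" by (simp add: distrib_right sum_distrib_right)
    finally show ?thesis .
  qed
  moreover have "?C \<ge> 0" using abar by (simp add: sum_nonneg)
  ultimately show ?thesis by blast
qed

text \<open>The combination \<open>\<Phi>(u) - \<Phi>'(u)u / q\<close> controls \<open>T = 1 + \<integral>|\<nabla>u|^2 + \<integral>a|u|^p\<close>, and \<open>\<Phi>'(u)u = sqrt T * \<Phi>'(u)(u / sqrt T)\<close> is \<open>O(sqrt T)\<close>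
  because the functions \<open>u / sqrt T\<close> are bounded in the energy space.\<close>

lemma palais_smale_bounded:
  fixes a b :: "int ^ 'n \<Rightarrow> real"
  assumes ps: "palais_smale p q a b c u" and pq: "2 \<le> p" "p < q"
    and a0: "\<And>x. a x \<ge> 0" and av: "vanishes (\<lambda>x. a x - abar)" and abar: "abar > 0"
  shows "E_bounded p u"
proof -
  have p: "0 < p" "p \<le> q" using pq by auto
  define A where "A n = (\<Sum>\<^sub>\<infinity>x. a x * \<bar>u n x\<bar> powr p)" for n
  define D where "D n = dirichlet (u n)" for n
  define T where "T n = 1 + D n + A n" for n
  have uE: "in_E p (u n)" for n using ps by (simp add: palais_smale_def E_space_eq[OF p])
  have A0: "A n \<ge> 0" for n unfolding A_def by (rule infsum_nonneg) (simp add: a0)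
  have D0: "D n \<ge> 0" for n by (simp add: D_def)
  have T1: "T n \<ge> 1" for n using A0[of n] D0[of n] by (simp add: T_def)
  obtain C where C: "C \<ge> 0" "\<And>u. in_E p u \<Longrightarrow>
      powr_sum p u \<le> C * (1 + dirichlet u + (\<Sum>\<^sub>\<infinity>x. a x * \<bar>u x\<bar> powr p)) powr (p / 2)"
    using powr_sum_le_coercive[OF pq(1) a0 av abar] by blast
  have PT: "powr_sum p (u n) \<le> C * T n powr (p / 2)" for n
    using C(2)[OF uE] by (simp add: T_def D_def A_def)
  define \<phi> where "\<phi> n x = (1 / sqrt (T n)) * u n x" for n x
  have "E_bounded p \<phi>"
    unfolding E_bounded_def
  proof (intro exI allI conjI)
    fix n
    show "in_E p (\<phi> n)" unfolding \<phi>_def by (rule in_E_cmult[OF uE])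
    have "dirichlet (\<phi> n) = D n / T n"
      unfolding \<phi>_def dirichlet_cmult using T1[of n] by (simp add: D_def power_divide)
    also have "\<dots> \<le> 1" using T1[of n] A0[of n] by (simp add: T_def)
    finally show "dirichlet (\<phi> n) \<le> max 1 C" by simp
    have "\<bar>1 / sqrt (T n)\<bar> = T n powr (- 1 / 2)"
      using T1[of n] by (simp add: powr_minus_divide powr_half_sqrt)
    then have "\<bar>1 / sqrt (T n)\<bar> powr p = T n powr (- (p / 2))" by (simp add: powr_powr)
    then have "powr_sum p (\<phi> n) = T n powr (- (p / 2)) * powr_sum p (u n)"
      unfolding \<phi>_def powr_sum_cmult by simp
    also have "\<dots> \<le> T n powr (- (p / 2)) * (C * T n powr (p / 2))"
      by (rule mult_left_mono[OF PT]) simp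
    also have "\<dots> = C" using T1[of n] by (simp add: powr_minus field_simps)
    finally show "powr_sum p (\<phi> n) \<le> max 1 C" by simp
  qed
  from palais_smale_deriv_tendsto_0[OF ps p this]
  have "Bseq (\<lambda>n. energy_deriv p q a b (u n) (\<phi> n))" by (intro convergent_imp_Bseq convergentI)
  then obtain K1 where K1: "K1 > 0" "\<And>n. \<bar>energy_deriv p q a b (u n) (\<phi> n)\<bar> \<le> K1"
    by (auto simp: Bseq_def)
  have "Bseq (\<lambda>n. energy p q a b (u n))"
    using ps unfolding palais_smale_def by (blast intro: convergent_imp_Bseq convergentI)
  then obtain K2 where K2: "K2 > 0" "\<And>n. \<bar>energy p q a b (u n)\<bar> \<le> K2" by (auto simp: Bseq_def)
  \<comment> \<open>The smaller of the coefficients of the Dirichlet and weighted p-sums in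
    \<Phi>(u) - \<Phi>'(u)u / q; positive since 2 \<le> p < q.\<close>
  define \<kappa> where "\<kappa> = min (1 / 2 - 1 / q) (1 / p - 1 / q)"
  have \<kappa>: "\<kappa> > 0" using pq by (simp add: \<kappa>_def frac_less2)
  \<comment> \<open>A bound for sqrt T: as sqrt T \<ge> 1, the inequality \<kappa> T \<le> K2 +
    \<kappa> + K1 sqrt T gives \<kappa> T \<le> (K2 + \<kappa> + K1) sqrt T.\<close>
  define R where "R = 1 + (K2 + \<kappa> + K1) / \<kappa>"
  have TR: "T n \<le> R\<^sup>2" for n
  proof -
    let ?t = "sqrt (T n)"
    have t1: "?t \<ge> 1" using T1 by simp
    have tt: "T n = ?t * ?t" using T1[of n] by simp
    have "energy_deriv p q a b (u n) (u n) = ?t * energy_deriv p q a b (u n) (\<phi> n)"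
      unfolding \<phi>_def energy_deriv_cmult using t1 by simp
    moreover have "\<bar>?t * energy_deriv p q a b (u n) (\<phi> n)\<bar> \<le> ?t * K1"
      using K1(2)[of n] t1 unfolding abs_mult by (intro mult_mono) auto
    ultimately have "\<bar>energy_deriv p q a b (u n) (u n)\<bar> \<le> ?t * K1" by simp
    moreover have "\<bar>(1 / q) * energy_deriv p q a b (u n) (u n)\<bar> \<le> 1 * \<bar>energy_deriv p q a b (u n) (u n)\<bar>"
      unfolding abs_mult using pq by (intro mult_right_mono) auto
    ultimately have 1: "energy p q a b (u n) - (1 / q) * energy_deriv p q a b (u n) (u n) \<le> K2 + ?t * K1"
      using K2(2)[of n] by linarith
    have "energy p q a b (u n) - (1 / q) * energy_deriv p q a b (u n) (u n)
        = (1 / 2 - 1 / q) * D n + (1 / p - 1 / q) * A n"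
      unfolding energy_eq energy_deriv_self A_def D_def by (simp add: algebra_simps)
    moreover have "\<kappa> * D n \<le> (1 / 2 - 1 / q) * D n" "\<kappa> * A n \<le> (1 / p - 1 / q) * A n"
      using D0 A0 by (auto simp: \<kappa>_def intro!: mult_right_mono)
    moreover have "\<kappa> * T n = \<kappa> + \<kappa> * D n + \<kappa> * A n" by (simp add: T_def algebra_simps)
    ultimately have "\<kappa> * T n \<le> K2 + \<kappa> + ?t * K1" using 1 by linarith
    also have "\<dots> \<le> ?t * (K2 + \<kappa> + K1)"
      using mult_right_mono[OF t1, of "K2 + \<kappa>"] K2(1) \<kappa> by (simp add: algebra_simps)
    finally have "\<kappa> * (?t * ?t) \<le> ?t * (K2 + \<kappa> + K1)" unfolding tt[symmetric] .
    then have "?t * (\<kappa> * ?t) \<le> ?t * (K2 + \<kappa> + K1)" by (simp only: mult.left_commute)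
    then have "\<kappa> * ?t \<le> K2 + \<kappa> + K1" using t1 by simp
    then have "?t \<le> (K2 + \<kappa> + K1) / \<kappa>" using \<kappa> by (simp add: field_simps)
    then have "?t \<le> R" by (simp add: R_def)
    then have "?t\<^sup>2 \<le> R\<^sup>2" using t1 by (intro power_mono) auto
    then show ?thesis using T1[of n] by simp
  qed
  show ?thesis unfolding E_bounded_def
  proof (intro exI allI conjI)
    fix n
    show "in_E p (u n)" by (rule uE)
    show "dirichlet (u n) \<le> max (R\<^sup>2) (C * (R\<^sup>2) powr (p / 2))"
      using TR[of n] A0[of n] by (simp add: T_def D_def)
    have "powr_sum p (u n) \<le> C * T n powr (p / 2)" by (rule PT)
    also have "\<dots> \<le> C * (R\<^sup>2) powr (p / 2)"
      using TR[of n] T1[of n] p C(1) by (intro mult_left_mono powr_mono2) auto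
    finally show "powr_sum p (u n) \<le> max (R\<^sup>2) (C * (R\<^sup>2) powr (p / 2))" by simp
  qed
qed

subsection \<open>The decomposition theorem\<close>

theorem theorem1p3:
  fixes p q abar bbar c :: real
    and a b :: "int ^ 'n \<Rightarrow> real"
    and u :: "nat \<Rightarrow> int ^ 'n \<Rightarrow> real"
  assumes "CARD('n) \<ge> 2"
    and "2 \<le> p" and "p < q"
    and "\<And>x. a x \<ge> 0" and "\<And>x. b x \<ge> 0"
    and "(a \<longlongrightarrow> abar) lattice_at_infinity" and "abar > 0"
    and "(b \<longlongrightarrow> bbar) lattice_at_infinity" and "bbar > 0"
    and "I0 p q (\<lambda>_ :: int ^ 'n. abar) (\<lambda>_. bbar) > 0"
    and "palais_smale p q a b c u"
  shows "\<exists>(k::nat) (u0 :: int ^ 'n \<Rightarrow> real) (U :: nat \<Rightarrow> int ^ 'n \<Rightarrow> real)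
            (y :: nat \<Rightarrow> nat \<Rightarrow> int ^ 'n).
      weak_solution p q a b u0 \<and>
      (\<forall>i\<in>{1..k}. weak_solution p q (\<lambda>_. abar) (\<lambda>_. bbar) (U i) \<and> nontrivial (U i)) \<and>
      (\<forall>i\<in>{1..k}. filterlim (\<lambda>n. lattice_dist (y i n) 0) at_top sequentially) \<and>
      (\<forall>i\<in>{1..k}. \<forall>j\<in>{1..k}. j \<noteq> i \<longrightarrow>
         filterlim (\<lambda>n. lattice_dist (y j n) (y i n)) at_top sequentially) \<and>
      (\<exists>r :: nat \<Rightarrow> nat. strict_mono r \<and>
         (\<lambda>n. E_norm p q (\<lambda>x. u (r n) x - u0 x - (\<Sum>i=1..k. U i (x - y i (r n))))) \<longlonglongrightarrow> 0) \<and>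
      energy p q a b u0 + (\<Sum>i=1..k. energy p q (\<lambda>_. abar) (\<lambda>_. bbar) (U i)) = c"
proof -
  have p: "p > 0" "p \<le> q" using assms(2,3) by auto
  have av: "vanishes (\<lambda>x. a x - abar)" and bv: "vanishes (\<lambda>x. b x - bbar)"
    using assms(6,8) by (simp_all add: vanishes_of_tendsto)
  have "E_bounded p u"
    by (rule palais_smale_bounded[OF assms(11,2,3,4) av assms(7)])
  then have ps: "ps_seq p q a b c u"
    using assms(11) palais_smale_deriv_tendsto_0[OF assms(11) p]
    by (simp add: ps_seq_def palais_smale_def)
  obtain M where "\<And>n x. \<bar>u n x\<bar> \<le> M" using E_bounded_abs_le[OF \<open>E_bounded p u\<close> p(1)] by blast
  from pointwise_convergent_subsequence[of u M, OF this]
  obtain r1 u0 where r1: "strict_mono (r1 :: nat \<Rightarrow> nat)" and lim: "\<And>x. (\<lambda>n. u (r1 n) x) \<longlonglongrightarrow> u0 x"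
    by blast
  note split = ps_seq_split[OF ps_seq_subseq[OF ps r1] assms(2,3) av bv lim]
  \<comment> \<open>\<open>I0\<close> is infinite when there are no nontrivial critical points, so a
    real number below it serves as the gap.\<close>
  obtain \<alpha> where \<alpha>: "0 < ereal \<alpha>" "ereal \<alpha> < I0 p q (\<lambda>_ :: int ^ 'n. abar) (\<lambda>_. bbar)"
    using ereal_dense2[OF assms(10)] by blast
  have gap: "\<alpha> \<le> energy p q (\<lambda>_. abar) (\<lambda>_. bbar) U" if "critical p q abar bbar U" for U :: "int ^ 'n \<Rightarrow> real"
  proof -
    have "U \<in> nontrivial_critical_points p q (\<lambda>_. abar) (\<lambda>_. bbar)"
      using that by (simp add: nontrivial_critical_points_def critical_def E_space_eq[OF p])
    then have "I0 p q (\<lambda>_ :: int ^ 'n. abar) (\<lambda>_. bbar) \<le> ereal (energy p q (\<lambda>_. abar) (\<lambda>_. bbar) U)"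
      unfolding I0_def by (rule INF_lower)
    with \<alpha>(2) have "ereal \<alpha> \<le> ereal (energy p q (\<lambda>_. abar) (\<lambda>_. bbar) U)"
      by (meson less_imp_le order_trans)
    then show ?thesis by simp
  qed
  obtain m :: nat where "c - energy p q a b u0 < real m * \<alpha>"
    using reals_Archimedean3[of \<alpha>] \<alpha>(1) by auto
  from bubble_decomposition[OF assms(2,3,7) gap split(3) this]
  obtain k U y r where tree:
    "bubble_tree p q abar bbar (c - energy p q a b u0) (\<lambda>n x. u (r1 n) x - u0 x) k U y r" by blast
  have r: "strict_mono r"
    and crit: "\<And>i. i \<in> {1..k} \<Longrightarrow> critical p q abar bbar (U i)"
    and drift: "\<And>i j. i \<in> {1..k} \<Longrightarrow> j \<in> {1..k} \<Longrightarrow> i \<noteq> j \<Longrightarrow> drifts_apart (y i) (y j)"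
    and esc: "\<And>z i. (\<And>x. (\<lambda>n. u (r1 n) (x + z n) - u0 (x + z n)) \<longlonglongrightarrow> 0) \<Longrightarrow> i \<in> {1..k} \<Longrightarrow>
        drifts_apart (y i) (\<lambda>n. z (r n))"
    and rem: "(\<lambda>n. E_norm p q (\<lambda>x. u (r1 (r n)) x - u0 x - (\<Sum>i=1..k. U i (x - y i n)))) \<longlonglongrightarrow> 0"
    and lev: "(\<Sum>i=1..k. energy p q (\<lambda>_. abar) (\<lambda>_. bbar) (U i)) = c - energy p q a b u0"
    using tree unfolding bubble_tree_def by blast+
  \<comment> \<open>Since u - u0 tends to 0 pointwise, the frame z = 0 is admissible; escaping from
    it means that the centres go to infinity.\<close>
  have esc0: "drifts_apart (y i) (\<lambda>n. 0)" if "i \<in> {1..k}" for i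
  proof (rule esc[OF _ that])
    show "(\<lambda>n. u (r1 n) (x + 0) - u0 (x + 0)) \<longlonglongrightarrow> 0" for x
      using tendsto_diff[OF lim[of x] tendsto_const[of "u0 x"]] by simp
  qed

  \<comment> \<open>The centres are only determined along \<open>R\<close>; \<open>s\<close> spreads them over all indices.\<close>
  define R where "R n = r1 (r n)" for n
  have R: "strict_mono R" using strict_mono_o[OF r1 r] by (simp add: R_def[abs_def] o_def)
  define s where "s n = (LEAST m. n \<le> R m)" for n
  have s_R: "s (R n) = n" for n
    unfolding s_def by (rule Least_equality) (use strict_mono_less_eq[OF R] in auto)
  have "n \<le> R (s n)" for n
    unfolding s_def by (rule LeastI[of _ n]) (rule strict_mono_imp_increasing[OF R])
  \<comment> \<open>Divergence of s carries the drift of the centres over to all indices n, as the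
    conclusion demands, and not only to those in the range of R.\<close>
  have s: "filterlim s sequentially sequentially"
    unfolding filterlim_at_top eventually_sequentially
  proof (intro allI exI impI)
    fix N n assume "R N \<le> n"
    then have "R N \<le> R (s n)" using \<open>n \<le> R (s n)\<close> by linarith
    then show "N \<le> s n" using strict_mono_less_eq[OF R] by simp
  qed
  define Y where "Y i n = y i (s n)" for i n

  have "weak_solution p q a b u0"
    using split(1,2) by (simp add: weak_solution_def E_space_eq[OF p] in_E_finitely_supported)
  moreover have "\<forall>i\<in>{1..k}. weak_solution p q (\<lambda>_. abar) (\<lambda>_. bbar) (U i) \<and> nontrivial (U i)"
    using crit by (simp add: weak_solution_def critical_def E_space_eq[OF p] in_E_finitely_supported)
  moreover have "\<forall>i\<in>{1..k}. filterlim (\<lambda>n. lattice_dist (Y i n) 0) at_top sequentially"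
    using drifts_apart_compose[OF esc0 s] by (auto simp: Y_def intro!: filterlim_lattice_dist)
  moreover have "\<forall>i\<in>{1..k}. \<forall>j\<in>{1..k}. j \<noteq> i \<longrightarrow>
      filterlim (\<lambda>n. lattice_dist (Y j n) (Y i n)) at_top sequentially"
    using drifts_apart_compose[OF drift s] by (auto simp: Y_def intro!: filterlim_lattice_dist)
  moreover have "(\<lambda>n. E_norm p q (\<lambda>x. u (R n) x - u0 x - (\<Sum>i=1..k. U i (x - Y i (R n))))) \<longlonglongrightarrow> 0"
    using rem by (simp add: Y_def s_R) (simp add: R_def)
  moreover have "energy p q a b u0 + (\<Sum>i=1..k. energy p q (\<lambda>_. abar) (\<lambda>_. bbar) (U i)) = c"
    using lev by simp
  ultimately show ?thesis using R by blast
qed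

end
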